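(* For each positive integer $n$, let $p=p(n)=n$ and let $X_1,\dots,X_{n+1}$ be i.i.d. random vectors with distribution $\mathcal{N}_n(\mu,\Sigma)$, where $\mu\in\mathbb{R}^n$ and $\Sigma$ is an $n\times n$ positive definite matrix ($\mu$, $\Sigma$ may depend on $n$). Let $\hat\Sigma$ be the sample covariance matrix. Then, as $n\to\infty$, $$\frac{\log\det\hat\Sigma-\log\big((n-1)!\big)+n\log n-\log\det\Sigma}{\sqrt{2\log n}}\ \longrightarrow\ \mathcal{N}(0,1)\quad\text{in distribution.}$$
   Context: The sample covariance matrix is $\hat\Sigma=\frac1n\sum_{k=1}^{n+1}(X_k-\bar X)(X_k-\bar X)^T$, where $\bar X=\frac{1}{n+1}\sum_{k=1}^{n+1}X_k$. *)

theory Defs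
  imports
    "HOL-Probability.Probability"
    "Jordan_Normal_Form.Determinant"
    "Jordan_Normal_Form.Gauss_Jordan_Elimination"
begin

unbundle no vec_syntax

definition positive_definite :: "nat \<Rightarrow> real mat \<Rightarrow> bool" where
  "positive_definite p A \<longleftrightarrow>
     A \<in> carrier_mat p p \<and> transpose_mat A = A \<and>
     (\<forall>v \<in> carrier_vec p. v \<noteq> 0\<^sub>v p \<longrightarrow> 0 < v \<bullet> (A *\<^sub>v v))"

text \<open>
  The dimension \<open>p\<close> varies, so random vectors take values in the product space
  \<open>\<Pi>\<^sub>M i\<in>{..<p}. borel\<close> of functions on the coordinates \<open>0, \<dots>, p - 1\<close>;
  \<open>Matrix.vec p\<close> turns such a function into an element of \<open>carrier_vec p\<close>.
  A density of such a vector is taken with respect to \<open>\<Pi>\<^sub>M i\<in>{..<p}. lborel\<close>,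
  the Lebesgue measure on these functions.
\<close>

definition mvnormal_density ::
    "nat \<Rightarrow> real Matrix.vec \<Rightarrow> real mat \<Rightarrow> (nat \<Rightarrow> real) \<Rightarrow> real" where
  "mvnormal_density p \<mu> \<Sigma> x =
     (let y = Matrix.vec p x - \<mu>
      in exp (- (y \<bullet> (the (mat_inverse \<Sigma>) *\<^sub>v y)) / 2)
           / sqrt ((2 * pi) ^ p * Determinant.det \<Sigma>))"

definition mvnormal_distributed ::
    "'a measure \<Rightarrow> nat \<Rightarrow> real Matrix.vec \<Rightarrow> real mat \<Rightarrow> ('a \<Rightarrow> nat \<Rightarrow> real) \<Rightarrow> bool" where
  "mvnormal_distributed M p \<mu> \<Sigma> X \<longleftrightarrow>
     distributed M (\<Pi>\<^sub>M i\<in>{..<p}. lborel) X (\<lambda>x. ennreal (mvnormal_density p \<mu> \<Sigma> x))"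

text \<open>The sample has size \<open>n + 1\<close>, indexed by \<open>1, \<dots>, n + 1\<close>.\<close>

definition sample_mean :: "nat \<Rightarrow> nat \<Rightarrow> (nat \<Rightarrow> real Matrix.vec) \<Rightarrow> real Matrix.vec" where
  "sample_mean p n x = Matrix.vec p (\<lambda>i. (\<Sum>k = 1..n + 1. x k $ i) / real (n + 1))"

definition sample_covariance :: "nat \<Rightarrow> nat \<Rightarrow> (nat \<Rightarrow> real Matrix.vec) \<Rightarrow> real mat" where
  "sample_covariance p n x =
     Matrix.mat p p (\<lambda>(i, j).
       (\<Sum>k = 1..n + 1. (x k - sample_mean p n x) $ i * (x k - sample_mean p n x) $ j) / real n)"

end

theory Submission
  imports Defs
begin

text \<open>
  Bordering the \<open>n + 1\<close> observations by a column of ones gives a square matrix \<open>A\<close> of size \<open>n + 1\<close>.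
  Subtracting the sample mean is a column operation, and it makes the Gram matrix of \<open>A\<close> block diagonal, so
  \<open>(det A)\<^sup>2\<close> is \<open>(n + 1) * n ^ n\<close> times the determinant of the sample covariance matrix
  (\<open>det_sample_covariance\<close>). Whitening the observations by a Cholesky factor of the inverse of \<open>\<Sigma>\<close>
  divides \<open>(det A)\<^sup>2\<close> by \<open>det \<Sigma>\<close> and turns the entries of \<open>A\<close> outside the column of ones into independent
  standard normal variables (\<open>distr_whitened_sample\<close>).

  For a matrix with one deterministic column \<open>u\<close> and otherwise standard normal entries, rotational
  invariance allows \<open>u\<close> to be a multiple of a coordinate vector. Expanding along it leaves a smaller Gaussian
  matrix, whose first column takes over the role of \<open>u\<close>. Hence the squared determinant has the law of the
  squared length of \<open>u\<close>, which is \<open>n + 1\<close> for the column of ones, times independent chi-square variables with \<open>1, \<dots>, n\<close> degrees of freedom. The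
  induction is carried out on expectations of \<open>x powr (\<i> s)\<close> (\<open>border_mellin_eq\<close>), which is all that is
  needed: these are the characteristic functions of the logarithm, and they factor into the functions
  \<open>2 powr (\<i> s) * Gamma (k / 2 + \<i> s) / Gamma (k / 2)\<close>.

  The statistic is therefore a normalised sum of independent log-chi-square variables. By a Taylor
  expansion of the log-gamma function these have mean \<open>ln k - 1 / k + O(1 / k\<^sup>2)\<close> and variance
  \<open>2 / k + O(1 / k\<^sup>2)\<close>. The means add up to \<open>ln ((n - 1)!) + O(1)\<close> and the variances to \<open>2 * ln n + O(1)\<close>.
  With \<open>s = t / sqrt (2 * ln n)\<close> the characteristic function then converges to \<open>exp (- t\<^sup>2 / 2)\<close>
  (\<open>prod_chi_square_mellin_tendsto\<close>), and Levy's continuity theorem concludes.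
\<close>

section \<open>The logarithm of the gamma function\<close>

text \<open>
  Comparison with the telescoping series \<open>1 / (a + k) - 1 / (a + k + 1)\<close>, whose terms lie between
  consecutive terms of the series of inverse squares.
\<close>

lemma sum_inverse_square_bounds:
  fixes a :: real assumes a: "a > 0"
  shows "summable (\<lambda>k. 1 / (a + real k)^2)"
    and "1 / a \<le> (\<Sum>k. 1 / (a + real k)^2)"
    and "(\<Sum>k. 1 / (a + real k)^2) \<le> 1 / a + 1 / a^2"
proof -
  define t where "t k = 1 / (a + real k) - 1 / (a + real (Suc k))" for k
  have t: "t sums (1 / a)"
  proof -
    have "(\<lambda>k. 1 / (a + real k)) \<longlonglongrightarrow> 0" by real_asymp
    from telescope_sums'[OF this] show ?thesis unfolding t_def by simp
  qed
  have t_eq: "t k = 1 / ((a + real k) * (a + real (Suc k)))" for k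
    using a by (simp add: t_def divide_simps add_nonneg_eq_0_iff)
  have t1: "t k \<le> 1 / (a + real k)^2" for k
    unfolding t_eq power2_eq_square using a by (intro frac_le mult_mono mult_pos_pos) auto
  have t2: "1 / (a + real (Suc k))^2 \<le> t k" for k
    unfolding t_eq power2_eq_square using a by (intro frac_le mult_mono mult_pos_pos) auto
  have s: "summable (\<lambda>k. 1 / (a + real (Suc k))^2)"
    by (rule summable_comparison_test'[OF sums_summable[OF t], of 0]) (use t2 in simp)
  then show s': "summable (\<lambda>k. 1 / (a + real k)^2)"
    using summable_Suc_iff[of "\<lambda>k. 1 / (a + real k)^2"] by simp
  show "1 / a \<le> (\<Sum>k. 1 / (a + real k)^2)"
    using suminf_le[OF t1 sums_summable[OF t] s'] sums_unique[OF t] by simp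
  have "(\<Sum>k. 1 / (a + real (Suc k))^2) \<le> 1 / a"
    using suminf_le[OF t2 s sums_summable[OF t]] sums_unique[OF t] by simp
  then show "(\<Sum>k. 1 / (a + real k)^2) \<le> 1 / a + 1 / a^2"
    using suminf_split_head[OF s'] by simp
qed

lemma Polygamma_1_bounds:
  fixes a :: real assumes "a > 0"
  shows "1 / a \<le> Polygamma 1 a" "Polygamma 1 a \<le> 1 / a + 1 / a^2"
  using sum_inverse_square_bounds[OF assms]
  by (simp_all add: Polygamma_def inverse_eq_divide numeral_2_eq_2)

text \<open>
  The decay \<open>1 / a\<^sup>2\<close> is what matters: at \<open>a = k / 2\<close> it makes the third-order Taylor errors summable
  over \<open>k\<close>, so that they do not accumulate as the number of factors grows.
\<close>

lemma norm_Polygamma_2_le: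
  fixes z :: complex assumes "a \<ge> 1/2" "Re z \<ge> a"
  shows "cmod (Polygamma 2 z) \<le> 6 / a^2"
proof -
  have a: "a > 0" using assms by simp
  let ?f = "\<lambda>k. inverse ((z + of_nat k)^3)" and ?g = "\<lambda>k. (1 / a) * (1 / (a + real k)^2)"
  have le: "cmod (?f k) \<le> ?g k" for k
  proof -
    have "a + real k \<le> Re (z + of_nat k)" using assms by simp
    also have "\<dots> \<le> cmod (z + of_nat k)" by (rule complex_Re_le_cmod)
    finally have "(a + real k)^3 \<le> cmod (z + of_nat k)^3" using a by (intro power_mono) auto
    moreover have "a * (a + real k)^2 \<le> (a + real k)^3"
      using a by (simp add: power3_eq_cube power2_eq_square)
    moreover have "0 < a * (a + real k)^2" using a
      by (intro mult_pos_pos zero_less_power) auto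
    ultimately have "0 < a * (a + real k)^2" "a * (a + real k)^2 \<le> cmod (z + of_nat k)^3"
      by linarith+
    then have "1 / cmod (z + of_nat k)^3 \<le> 1 / (a * (a + real k)^2)"
      by (intro frac_le) auto
    then show ?thesis by (simp add: norm_inverse norm_power norm_divide inverse_eq_divide)
  qed
  have sg: "summable ?g" by (intro summable_mult sum_inverse_square_bounds(1) a)
  have "cmod (\<Sum>k. ?f k) \<le> (\<Sum>k. ?g k)" by (rule norm_suminf_le[OF le sg])
  also have "\<dots> = (1/a) * (\<Sum>k. 1 / (a + real k)^2)"
    by (rule suminf_mult[OF sum_inverse_square_bounds(1)[OF a]])
  also have "\<dots> \<le> (1/a) * (1/a + 1/a^2)"
    using a by (intro mult_left_mono sum_inverse_square_bounds(3)) auto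
  also have "\<dots> \<le> 3 / a^2"
    using assms a by (simp add: divide_simps power2_eq_square)
  finally have "cmod (\<Sum>k. ?f k) \<le> 3 / a^2" .
  moreover have "Polygamma 2 z = - 2 * (\<Sum>k. ?f k)"
    by (simp add: Polygamma_def)
  ultimately show ?thesis by (simp add: norm_mult)
qed

text \<open>
  This expansion around a real point is used twice, along the real axis with \<open>w = a + 1\<close>, where it yields
  the asymptotics of the digamma function, and in the imaginary direction with \<open>w = a + \<i> s\<close>, where it
  yields those of the Mellin transforms.
\<close>

lemma ln_Gamma_Taylor:
  fixes w :: complex assumes a: "a \<ge> 1/2" and w: "Re w \<ge> a"
  shows "cmod (ln_Gamma w - of_real (ln_Gamma a) - of_real (Digamma a) * (w - of_real a)
                - of_real (Polygamma 1 a) * (w - of_real a)^2 / 2)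
          \<le> 3 / a^2 * cmod (w - of_real a)^3"
proof -
  define f :: "nat \<Rightarrow> complex \<Rightarrow> complex"
    where "f i = (if i = 0 then ln_Gamma else Polygamma (i - 1))" for i
  let ?S = "{z. Re z \<ge> a}" and ?a = "complex_of_real a"
  have a0: "a > 0" using a by simp
  have "cmod (f 0 w - (\<Sum>i\<le>2. f i ?a * (w - ?a) ^ i / fact i))
          \<le> (6 / a^2) * cmod (w - ?a) ^ Suc 2 / fact 2"
  proof (rule complex_Taylor[of ?S])
    show "convex ?S" using convex_halfspace_Re_ge by blast
    fix i x assume x: "x \<in> ?S"
    have x': "x \<notin> \<real>\<^sub>\<le>\<^sub>0" "x \<notin> \<int>\<^sub>\<le>\<^sub>0"
      using x a0 by (auto simp: complex_nonpos_Reals_iff elim!: nonpos_Ints_cases)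
    show "(f i has_field_derivative f (Suc i) x) (at x within ?S)"
    proof (cases i)
      case 0
      then show ?thesis using x'
        by (auto simp: f_def intro!: has_field_derivative_at_within[OF has_field_derivative_ln_Gamma_complex])
    next
      case (Suc j)
      then show ?thesis using x' has_field_derivative_Polygamma[of x j ?S] by (simp add: f_def)
    qed
    show "cmod (f (Suc 2) x) \<le> 6 / a^2"
      using norm_Polygamma_2_le[OF a, of x] x by (simp add: f_def)
  qed (use w in auto)
  moreover have "(\<Sum>i\<le>2. f i ?a * (w - ?a) ^ i / fact i) = ln_Gamma ?a + Digamma ?a * (w - ?a)
      + Polygamma 1 ?a * (w - ?a)^2 / 2"
    by (simp add: f_def atMost_nat_numeral)
  moreover have "Polygamma n ?a = of_real (Polygamma n a)" for n
    using Polygamma_of_real[of a n] a0 by simp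
  ultimately show ?thesis using a0
    by (simp add: f_def ln_Gamma_complex_of_real diff_diff_eq add.assoc)
qed

text \<open>
  The functional equation gives \<open>ln_Gamma (a + 1) - ln_Gamma a = ln a\<close>; expanding the left-hand side
  around \<open>a\<close> expresses \<open>ln a\<close> through the first two derivatives at \<open>a\<close>. The term \<open>1 / (2 * a)\<close> has to
  be kept: summed over \<open>a = k / 2\<close> it contributes a logarithm, which moves the centring constant from
  \<open>ln (n!)\<close> to \<open>ln ((n - 1)!)\<close>.
\<close>

lemma Digamma_approx:
  fixes a :: real assumes a: "a \<ge> 1/2"
  shows "\<bar>Digamma a - (ln a - 1 / (2 * a))\<bar> \<le> 7 / (2 * a^2)"
proof -
  have a0: "a > 0" using a by simp
  have G: "ln_Gamma (a + 1) - ln_Gamma a = ln a"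
    using a0 Gamma_plus1[of a] by (simp add: ln_Gamma_real_pos ln_mult_pos nonpos_Ints_def)
  have "cmod (ln_Gamma (of_real (a + 1)) - of_real (ln_Gamma a) - of_real (Digamma a) * 1
                - of_real (Polygamma 1 a) * 1^2 / 2) \<le> 3 / a^2"
    using ln_Gamma_Taylor[OF a, of "of_real (a + 1)"] by simp
  also have "ln_Gamma (of_real (a + 1)) - of_real (ln_Gamma a) - of_real (Digamma a) * 1
                - of_real (Polygamma 1 a) * 1^2 / 2
       = complex_of_real (ln a - Digamma a - Polygamma 1 a / 2)"
    using a0 ln_Gamma_complex_of_real[of "a+1"] by (simp add: G[symmetric])
  finally have "\<bar>ln a - Digamma a - Polygamma 1 a / 2\<bar> \<le> 3 / a^2" by (simp only: norm_of_real)
  then show ?thesis using Polygamma_1_bounds[OF a0] by (simp add: field_simps abs_le_iff)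
qed

text \<open>
  This is \<open>2 powr (\<i> s) * Gamma (k / 2 + \<i> s) / Gamma (k / 2)\<close>, the characteristic function at \<open>s\<close> of the logarithm
  of a chi-square variable with \<open>k\<close> degrees of freedom. It is written with logarithms so that products
  over \<open>k\<close> become sums.
\<close>

definition chi_square_mellin :: "nat \<Rightarrow> real \<Rightarrow> complex" where
  "chi_square_mellin k s = exp (\<i> * of_real (s * ln 2) + ln_Gamma (of_real (real k / 2) + \<i> * of_real s)
                          - of_real (ln_Gamma (real k / 2)))"

text \<open>
  The first two derivatives of the log-gamma function at \<open>k / 2\<close> supply the mean \<open>ln k - 1 / k\<close> and the
  variance \<open>2 / k\<close>. The errors of first, second and third order in \<open>s\<close> come from approximating these
  two derivatives and from the Taylor remainder, respectively.
\<close>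

lemma chi_square_mellin_expansion:
  assumes k: "k \<ge> 1"
  shows "\<exists>e. cmod e \<le> (14 * \<bar>s\<bar> + 2 * s^2 + 12 * \<bar>s\<bar>^3) / real k^2 \<and>
    chi_square_mellin k s = exp (\<i> * of_real (s * (ln (real k) - 1 / real k)) - of_real (s^2 / real k) + e)"
proof -
  define a where "a = real k / 2"
  have a: "a \<ge> 1/2" "a > 0" using k by (auto simp: a_def)
  define w where "w = complex_of_real a + \<i> * of_real s"
  define r where "r = ln_Gamma w - of_real (ln_Gamma a) - of_real (Digamma a) * (w - of_real a)
                - of_real (Polygamma 1 a) * (w - of_real a)^2 / 2"
  define e1 where "e1 = Digamma a - (ln a - 1 / (2 * a))"
  define e2 where "e2 = Polygamma 1 a - 1 / a"
  define e where "e = r + \<i> * of_real (s * e1) - of_real (s^2 * e2 / 2)"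
  have r: "cmod r \<le> 3 / a^2 * \<bar>s\<bar>^3"
    using ln_Gamma_Taylor[OF a(1), of w] by (simp add: r_def w_def norm_mult)
  have e1: "\<bar>e1\<bar> \<le> 7 / (2 * a^2)" unfolding e1_def by (rule Digamma_approx[OF a(1)])
  have e2: "\<bar>e2\<bar> \<le> 1 / a^2" using Polygamma_1_bounds[OF a(2)] by (simp add: e2_def)
  have "cmod e \<le> cmod r + cmod (\<i> * of_real (s * e1)) + cmod (of_real (s^2 * e2 / 2))"
    unfolding e_def by (intro order_trans[OF norm_triangle_ineq4] add_right_mono norm_triangle_ineq)
  also have "\<dots> = cmod r + \<bar>s\<bar> * \<bar>e1\<bar> + s^2 * \<bar>e2\<bar> / 2"
    by (simp add: norm_mult abs_mult norm_power norm_divide)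
  also have "\<dots> \<le> 3 / a^2 * \<bar>s\<bar>^3 + \<bar>s\<bar> * (7 / (2 * a^2)) + s^2 * (1 / a^2) / 2"
    using r e1 e2 by (intro add_mono mult_left_mono divide_right_mono) auto
  also have "\<dots> = (14 * \<bar>s\<bar> + 2 * s^2 + 12 * \<bar>s\<bar>^3) / real k^2"
    using k by (simp add: a_def field_simps)
  finally have "cmod e \<le> (14 * \<bar>s\<bar> + 2 * s^2 + 12 * \<bar>s\<bar>^3) / real k^2" .
  moreover have "\<i> * of_real (s * ln 2) + ln_Gamma w - of_real (ln_Gamma a)
    = \<i> * of_real (s * (ln (real k) - 1 / real k)) - of_real (s^2 / real k) + e"
  proof -
    have "ln_Gamma w = r + of_real (ln_Gamma a) + of_real (ln a - 1 / (2 * a) + e1) * (w - of_real a)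
                + of_real (1 / a + e2) * (w - of_real a)^2 / 2"
      by (simp add: r_def e1_def e2_def)
    moreover have "ln a - 1 / (2 * a) + e1 = ln (real k) - 1 / real k - ln 2 + e1" "1 / a = 2 / real k"
      using k by (simp_all add: a_def ln_div)
    moreover have "w - of_real a = \<i> * of_real s" by (simp add: w_def)
    ultimately have "ln_Gamma w = r + of_real (ln_Gamma a)
        + of_real (ln (real k) - 1 / real k - ln 2 + e1) * (\<i> * of_real s)
                + of_real (2 / real k + e2) * (\<i> * of_real s)^2 / 2"
      by (simp only:)
    then show ?thesis
      by (simp add: e_def algebra_simps power_mult_distrib add_divide_distrib diff_divide_distrib)
  qed
  ultimately show ?thesis unfolding chi_square_mellin_def a_def[symmetric] w_def[symmetric] by metis
qed

text \<open>
  Up to errors that are summable over \<open>k\<close> and vanish with \<open>s\<close>, the imaginary part of the exponent is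
  \<open>s * (ln (n!) - harm n - ln ((n - 1)!)) = s * (ln n - harm n)\<close>, which vanishes in the limit because
  \<open>harm n - ln n\<close> converges and \<open>s\<close> tends to \<open>0\<close>; the real part is
  \<open>- s\<^sup>2 * harm n\<close>, and \<open>s\<^sup>2 * harm n\<close> tends to \<open>t\<^sup>2 / 2\<close> because \<open>s\<^sup>2 = t\<^sup>2 / (2 * ln n)\<close>.
\<close>

lemma prod_chi_square_mellin_tendsto:
  fixes t :: real
  defines "s \<equiv> \<lambda>n. t / sqrt (2 * ln (real n))"
  shows "(\<lambda>n. exp (- (\<i> * of_real (s n * ln (fact (n - 1))))) * (\<Prod>k=1..n. chi_square_mellin k (s n)))
           \<longlonglongrightarrow> exp (- of_real (t^2 / 2))"
proof -
  define B where "B n = 14 * \<bar>s n\<bar> + 2 * s n^2 + 12 * \<bar>s n\<bar>^3" for n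
  have "\<exists>e. \<forall>n. \<forall>k\<ge>1. cmod (e n k) \<le> B n / real k^2 \<and>
    chi_square_mellin k (s n) = exp (\<i> * of_real (s n * (ln (real k) - 1 / real k)) - of_real (s n^2 / real k) + e n k)"
    using chi_square_mellin_expansion unfolding B_def by (intro choice allI) (metis (no_types, lifting))
  then obtain e where e: "\<And>n k. k \<ge> 1 \<Longrightarrow> cmod (e n k) \<le> B n / real k^2"
    and chi: "\<And>n k. k \<ge> 1 \<Longrightarrow> chi_square_mellin k (s n) =
      exp (\<i> * of_real (s n * (ln (real k) - 1 / real k)) - of_real (s n^2 / real k) + e n k)"
    by blast
  have s0: "s \<longlonglongrightarrow> 0" unfolding s_def by real_asymp
  have B0: "B \<longlonglongrightarrow> 0" unfolding B_def
    by (rule tendsto_eq_intros s0 refl | simp)+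
  have E0: "(\<lambda>n. \<Sum>k=1..n. e n k) \<longlonglongrightarrow> 0"
  proof (rule Lim_null_comparison)
    have sq: "summable (\<lambda>k. 1 / real k^2)" using inverse_power_summable[of 2] by (simp add: inverse_eq_divide)
    show "(\<lambda>n. B n * (\<Sum>k. 1 / real k^2)) \<longlonglongrightarrow> 0"
      using tendsto_mult_right[OF B0] by simp
    show "\<forall>\<^sub>F n in sequentially. cmod (\<Sum>k=1..n. e n k) \<le> B n * (\<Sum>k. 1 / real k^2)"
    proof (intro always_eventually allI)
      fix n
      have "cmod (\<Sum>k=1..n. e n k) \<le> (\<Sum>k=1..n. B n / real k^2)"
        by (intro sum_norm_le e) auto
      also have "\<dots> = B n * (\<Sum>k=1..n. 1 / real k^2)" by (simp add: sum_distrib_left)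
      also have "\<dots> \<le> B n * (\<Sum>k. 1 / real k^2)"
        by (intro mult_left_mono sum_le_suminf sq) (auto simp: B_def)
      finally show "cmod (\<Sum>k=1..n. e n k) \<le> B n * (\<Sum>k. 1 / real k^2)" .
    qed
  qed
  define c where "c n = s n * (ln (real n) - harm n)" for n
  define d where "d n = s n^2 * harm n" for n
  have c0: "c \<longlonglongrightarrow> 0"
    using tendsto_mult[OF s0 tendsto_minus[OF euler_mascheroni_LIMSEQ]] by (simp add: c_def [abs_def])
  have d0: "d \<longlonglongrightarrow> t^2 / 2"
  proof -
    have "(\<lambda>n. t^2 / 2 + t^2 / (2 * ln (real n)) * (harm n - ln (real n))) \<longlonglongrightarrow> t^2 / 2 + 0 * euler_mascheroni"
      by (intro tendsto_intros euler_mascheroni_LIMSEQ) real_asymp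
    moreover have "\<forall>\<^sub>F n in sequentially. t^2 / 2 + t^2 / (2 * ln (real n)) * (harm n - ln (real n)) = d n"
      using eventually_gt_at_top[of 1]
    proof eventually_elim
      case (elim n)
      then have L: "ln (real n) > 0" by simp
      then have "t^2 / (2 * ln (real n)) * (harm n - ln (real n))
          = t^2 / (2 * ln (real n)) * harm n - t^2 / 2" by (simp add: right_diff_distrib)
      moreover have "s n^2 = t^2 / (2 * ln (real n))" using L by (simp add: s_def power_divide)
      ultimately show ?case by (simp add: d_def)
    qed
    ultimately show ?thesis using Lim_transform_eventually by fastforce
  qed
  have "(\<lambda>n. exp (\<i> * of_real (c n) - of_real (d n) + (\<Sum>k=1..n. e n k))) \<longlonglongrightarrow>
          exp (\<i> * of_real 0 - of_real (t^2 / 2) + 0)"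
    by (intro tendsto_intros c0 d0 E0)
  moreover have "\<forall>\<^sub>F n in sequentially. exp (\<i> * of_real (c n) - of_real (d n) + (\<Sum>k=1..n. e n k)) =
     exp (- (\<i> * of_real (s n * ln (fact (n - 1))))) * (\<Prod>k=1..n. chi_square_mellin k (s n))"
    using eventually_gt_at_top[of 0]
  proof eventually_elim
    case (elim n)
    have lf: "ln (fact n) = (\<Sum>k=1..n. ln (real k))" for n
      by (induction n) (simp_all add: ln_mult_pos)
    have lf': "ln (fact (n - 1)) = ln (fact n :: real) - ln (real n)"
      using elim by (simp add: fact_reduce ln_mult_pos)
    have h: "harm n = (\<Sum>k=1..n. 1 / real k)" by (simp add: harm_def inverse_eq_divide)
    have "(\<Prod>k=1..n. chi_square_mellin k (s n)) =
      exp (\<Sum>k=1..n. \<i> * of_real (s n * (ln (real k) - 1 / real k)) - of_real (s n^2 / real k) + e n k)"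
      by (simp add: exp_sum chi)
    also have "(\<Sum>k=1..n. \<i> * of_real (s n * (ln (real k) - 1 / real k)) - of_real (s n^2 / real k) + e n k)
      = \<i> * of_real (s n * (ln (fact n) - harm n)) - of_real (s n^2 * harm n) + (\<Sum>k=1..n. e n k)"
      unfolding lf h by (simp add: sum.distrib sum_subtractf sum_distrib_left right_diff_distrib)
    finally have *: "(\<Prod>k=1..n. chi_square_mellin k (s n)) = exp (\<i> * of_real (s n * (ln (fact n) - harm n))
        - of_real (d n) + (\<Sum>k=1..n. e n k))" unfolding d_def .
    have "\<i> * of_real (c n) - of_real (d n) + (\<Sum>k=1..n. e n k)
      = - (\<i> * of_real (s n * ln (fact (n - 1)))) +
        (\<i> * of_real (s n * (ln (fact n) - harm n)) - of_real (d n) + (\<Sum>k=1..n. e n k))"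
      unfolding lf' c_def by (simp add: algebra_simps)
    then show ?case unfolding * exp_add[symmetric] by (simp only:)
  qed
  ultimately show ?thesis using Lim_transform_eventually by fastforce
qed

section \<open>Rotation invariance of the standard Gaussian measure\<close>

text \<open>
  For \<open>c \<noteq> 0\<close> the rotation is a composition of two maps that each change a single coordinate by an
  affine map, with factors \<open>c\<close> and \<open>1 / c\<close>, so that the two scalings cancel. For \<open>c = 0\<close> it is a swap
  followed by a reflection.
\<close>

lemma nn_integral_rotate_lborel:
  fixes f :: "real \<times> real \<Rightarrow> ennreal" and c s :: real
  assumes f[measurable]: "f \<in> borel_measurable (borel \<Otimes>\<^sub>M borel)" and cs: "c\<^sup>2 + s\<^sup>2 = 1"
  shows "(\<integral>\<^sup>+y. \<integral>\<^sup>+x. f (c * x - s * y, s * x + c * y) \<partial>lborel \<partial>lborel)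
       = (\<integral>\<^sup>+y. \<integral>\<^sup>+x. f (x, y) \<partial>lborel \<partial>lborel)"
proof (cases "c = 0")
  case False
  define C where "C = ennreal \<bar>c\<bar>"
  have C: "C \<noteq> 0" "C \<noteq> \<top>" using False by (auto simp: C_def)
  \<comment> \<open>The second coordinate, rewritten in terms of the new first coordinate.\<close>
  have pt: "s * x + c * y = (s / c) * (c * x - s * y) + (1 / c) * y" for x y
  proof -
    have "(s / c) * (c * x - s * y) + (1 / c) * y = s * x + (1 - s\<^sup>2) / c * y"
      using False by (simp add: field_simps power2_eq_square)
    also have "1 - s\<^sup>2 = c * c" using cs by (simp add: power2_eq_square)
    finally show ?thesis using False by simp
  qed
  have inner: "C * (\<integral>\<^sup>+x. f (c * x - s * y, s * x + c * y) \<partial>lborel)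
      = (\<integral>\<^sup>+x. f (x, (s / c) * x + (1 / c) * y) \<partial>lborel)" for y
    using nn_integral_real_affine[of "\<lambda>x. f (x, (s / c) * x + (1 / c) * y)" c "- s * y"] False
    by (simp add: pt C_def)
  have outer: "C * (\<integral>\<^sup>+y. f (x, y) \<partial>lborel) = (\<integral>\<^sup>+y. f (x, (s / c) * x + (1 / c) * y) \<partial>lborel)" for x
  proof -
    have "C * (\<integral>\<^sup>+y. f (x, y) \<partial>lborel)
        = C * (ennreal \<bar>1 / c\<bar> * (\<integral>\<^sup>+y. f (x, (s / c) * x + (1 / c) * y) \<partial>lborel))"
      using nn_integral_real_affine[of "\<lambda>y. f (x, y)" "1 / c" "(s / c) * x"] False by simp
    also have "\<dots> = (C * ennreal \<bar>1 / c\<bar>) * (\<integral>\<^sup>+y. f (x, (s / c) * x + (1 / c) * y) \<partial>lborel)"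
      by (simp only: mult.assoc)
    also have "C * ennreal \<bar>1 / c\<bar> = 1"
      using False by (simp add: C_def ennreal_mult'[symmetric] abs_mult[symmetric])
    finally show ?thesis by simp
  qed
  have "C * (\<integral>\<^sup>+y. \<integral>\<^sup>+x. f (c * x - s * y, s * x + c * y) \<partial>lborel \<partial>lborel)
      = (\<integral>\<^sup>+y. \<integral>\<^sup>+x. f (x, (s / c) * x + (1 / c) * y) \<partial>lborel \<partial>lborel)"
    by (subst nn_integral_cmult[symmetric]) (simp_all add: inner)
  also have "\<dots> = (\<integral>\<^sup>+x. \<integral>\<^sup>+y. f (x, (s / c) * x + (1 / c) * y) \<partial>lborel \<partial>lborel)"
    by (intro lborel_pair.Fubini') measurable
  also have "\<dots> = C * (\<integral>\<^sup>+x. \<integral>\<^sup>+y. f (x, y) \<partial>lborel \<partial>lborel)"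
    by (subst nn_integral_cmult[symmetric]) (simp_all add: outer)
  also have "(\<integral>\<^sup>+x. \<integral>\<^sup>+y. f (x, y) \<partial>lborel \<partial>lborel) = (\<integral>\<^sup>+y. \<integral>\<^sup>+x. f (x, y) \<partial>lborel \<partial>lborel)"
    by (intro lborel_pair.Fubini') measurable
  finally show ?thesis using C by (simp add: ennreal_mult_cancel_left)
next
  case True
  then have s: "\<bar>s\<bar> = 1" using cs by (simp add: abs_square_eq_1)
  have flip: "(\<integral>\<^sup>+x. g (a * x) \<partial>lborel) = (\<integral>\<^sup>+x. g x \<partial>lborel)"
    if [measurable]: "g \<in> borel_measurable borel" and "\<bar>a\<bar> = 1" for g :: "real \<Rightarrow> ennreal" and a
    using nn_integral_real_affine[of g a 0] that by auto
  have "(\<integral>\<^sup>+y. \<integral>\<^sup>+x. f (- s * y, s * x) \<partial>lborel \<partial>lborel) = (\<integral>\<^sup>+y. \<integral>\<^sup>+x. f (- s * y, x) \<partial>lborel \<partial>lborel)"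
    by (rule nn_integral_cong, rule flip) (measurable, rule s)
  also have "\<dots> = (\<integral>\<^sup>+x. \<integral>\<^sup>+y. f (- s * y, x) \<partial>lborel \<partial>lborel)"
    by (intro lborel_pair.Fubini') measurable
  also have "\<dots> = (\<integral>\<^sup>+x. \<integral>\<^sup>+y. f (y, x) \<partial>lborel \<partial>lborel)"
    proof (rule nn_integral_cong)
    fix x
    show "(\<integral>\<^sup>+y. f (- s * y, x) \<partial>lborel) = (\<integral>\<^sup>+y. f (y, x) \<partial>lborel)"
      using flip[of "\<lambda>y. f (y, x)" "- s"] s by simp
  qed
  finally show ?thesis using True by simp
qed

lemma nn_integral_rotate_std_normal:
  fixes f :: "real \<times> real \<Rightarrow> ennreal" and c s :: real
  assumes f[measurable]: "f \<in> borel_measurable (borel \<Otimes>\<^sub>M borel)" and cs: "c\<^sup>2 + s\<^sup>2 = 1"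
  shows "(\<integral>\<^sup>+y. \<integral>\<^sup>+x. f (c * x - s * y, s * x + c * y) \<partial>std_normal_distribution \<partial>std_normal_distribution)
       = (\<integral>\<^sup>+y. \<integral>\<^sup>+x. f (x, y) \<partial>std_normal_distribution \<partial>std_normal_distribution)"
proof -
  define F where "F z = ennreal (std_normal_density (fst z) * std_normal_density (snd z)) * f z" for z
  have [measurable]: "F \<in> borel_measurable (borel \<Otimes>\<^sub>M borel)" unfolding F_def by measurable
  have inv: "std_normal_density (c * x - s * y) * std_normal_density (s * x + c * y)
      = std_normal_density x * std_normal_density y" for x y
  proof -
    have "(c * x - s * y)\<^sup>2 + (s * x + c * y)\<^sup>2 = (c\<^sup>2 + s\<^sup>2) * (x\<^sup>2 + y\<^sup>2)"
      by (simp add: power2_eq_square algebra_simps)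
    then have "(c * x - s * y)\<^sup>2 + (s * x + c * y)\<^sup>2 = x\<^sup>2 + y\<^sup>2" using cs by simp
    moreover have "std_normal_density x * std_normal_density y
        = 1 / (2 * pi) * exp (- (x\<^sup>2 + y\<^sup>2) / 2)" for x y
      by (simp add: std_normal_density_def exp_add[symmetric] add_divide_distrib)
    ultimately show ?thesis by simp
  qed
  have dens: "(\<integral>\<^sup>+y. \<integral>\<^sup>+x. g x y \<partial>std_normal_distribution \<partial>std_normal_distribution)
      = (\<integral>\<^sup>+y. \<integral>\<^sup>+x. ennreal (std_normal_density x * std_normal_density y) * g x y \<partial>lborel \<partial>lborel)"
    if [measurable]: "(\<lambda>(x, y). g x y) \<in> borel_measurable (borel \<Otimes>\<^sub>M borel)" for g :: "real \<Rightarrow> real \<Rightarrow> ennreal"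
  proof -
    have "(\<integral>\<^sup>+y. \<integral>\<^sup>+x. g x y \<partial>std_normal_distribution \<partial>std_normal_distribution)
       = (\<integral>\<^sup>+y. ennreal (std_normal_density y) * (\<integral>\<^sup>+x. ennreal (std_normal_density x) * g x y \<partial>lborel) \<partial>lborel)"
      by (simp add: nn_integral_density)
    also have "\<dots> = (\<integral>\<^sup>+y. \<integral>\<^sup>+x. ennreal (std_normal_density x * std_normal_density y) * g x y \<partial>lborel \<partial>lborel)"
      by (subst nn_integral_cmult[symmetric]) (auto simp: ennreal_mult' mult_ac)
    finally show ?thesis .
  qed
  show ?thesis
    using nn_integral_rotate_lborel[of F c s] cs
    by (subst (1 2) dens) (simp_all add: F_def inv case_prod_unfold)
qed

text \<open>
  The index set is a parameter because the proof works with vectors and matrices of varying size, and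
  cuts a Gaussian matrix into rows, columns and minors.
\<close>

definition gauss :: "'i set \<Rightarrow> ('i \<Rightarrow> real) measure" where
  "gauss I = PiM I (\<lambda>_. std_normal_distribution)"

interpretation std_normal: prob_space std_normal_distribution
  by (rule prob_space_normal_density) simp

interpretation gauss_prod: product_sigma_finite "\<lambda>_. std_normal_distribution"
  by unfold_locales

lemma prob_space_gauss: "prob_space (gauss I)"
  unfolding gauss_def by (intro prob_space_PiM std_normal.prob_space_axioms)

lemma sets_gauss[measurable_cong]: "sets (gauss I) = sets (PiM I (\<lambda>_. borel))"
  unfolding gauss_def by (intro sets_PiM_cong) auto

lemma space_gauss: "space (gauss I) = extensional I"
  unfolding gauss_def by (auto simp: space_PiM PiE_def)

definition rot :: "real \<Rightarrow> real \<Rightarrow> 'i \<Rightarrow> 'i \<Rightarrow> ('i \<Rightarrow> real) \<Rightarrow> 'i \<Rightarrow> real" where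
  "rot c s p q x = x(p := c * x p - s * x q, q := s * x p + c * x q)"

lemma measurable_rot:
  assumes "p \<in> I" "q \<in> I"
  shows "rot c s p q \<in> gauss I \<rightarrow>\<^sub>M gauss I"
proof -
  have "(\<lambda>x. rot c s p q x) \<in> PiM I (\<lambda>_. borel) \<rightarrow>\<^sub>M PiM I (\<lambda>_. borel)"
    unfolding rot_def
    by (rule measurable_fun_upd[where J=I], use assms in blast, rule measurable_fun_upd[where J=I])
       (use assms in auto)
  then show ?thesis by (simp cong: measurable_cong_sets add: sets_gauss)
qed

lemma gauss_rot:
  assumes I: "finite I" "p \<in> I" "q \<in> I" "p \<noteq> q" and cs: "c\<^sup>2 + s\<^sup>2 = 1"
  shows "distr (gauss I) (gauss I) (rot c s p q) = gauss I"
proof (rule measure_eqI)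
  fix A assume "A \<in> sets (distr (gauss I) (gauss I) (rot c s p q))"
  then have A[measurable]: "A \<in> sets (gauss I)" by simp
  define K where "K = I - {p, q}"
  have K: "I = insert p (insert q K)" "finite K" "q \<notin> K" "p \<notin> insert q K" using I by (auto simp: K_def)
  note [measurable] = measurable_rot[OF I(2,3), of c s]
  have split: "(\<integral>\<^sup>+x. f x \<partial>gauss I) = (\<integral>\<^sup>+z. \<integral>\<^sup>+y. \<integral>\<^sup>+x. f (z(q := y, p := x))
      \<partial>std_normal_distribution \<partial>std_normal_distribution \<partial>gauss K)"
    if [measurable]: "f \<in> borel_measurable (gauss I)" for f :: "_ \<Rightarrow> ennreal"
  proof -
    have f: "f \<in> borel_measurable (PiM (insert p (insert q K)) (\<lambda>_. std_normal_distribution))"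
      using that unfolding gauss_def K(1) .
    have "(\<integral>\<^sup>+x. f x \<partial>gauss I) = (\<integral>\<^sup>+z. \<integral>\<^sup>+x. f (z(p := x))
      \<partial>std_normal_distribution \<partial>gauss (insert q K))"
      unfolding gauss_def by (subst K(1), subst gauss_prod.product_nn_integral_insert) (use K f in auto)
    also have "\<dots> = (\<integral>\<^sup>+z. \<integral>\<^sup>+y. \<integral>\<^sup>+x. f (z(q := y, p := x))
      \<partial>std_normal_distribution \<partial>std_normal_distribution \<partial>gauss K)"
      unfolding gauss_def
    proof (subst gauss_prod.product_nn_integral_insert)
      show "(\<lambda>z. \<integral>\<^sup>+ x. f (z(p := x)) \<partial>std_normal_distribution)
        \<in> borel_measurable (Pi\<^sub>M (insert q K) (\<lambda>_. std_normal_distribution))"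
      proof (rule std_normal.borel_measurable_nn_integral)
        show "(\<lambda>(z, x). f (z(p := x))) \<in> borel_measurable
          (Pi\<^sub>M (insert q K) (\<lambda>_. std_normal_distribution) \<Otimes>\<^sub>M std_normal_distribution)"
          using measurable_compose[OF measurable_add_dim f] by (simp add: case_prod_unfold)
      qed
    qed (use K in auto)
    finally show ?thesis .
  qed
  have "emeasure (distr (gauss I) (gauss I) (rot c s p q)) A = (\<integral>\<^sup>+x. indicator A (rot c s p q x) \<partial>gauss I)"
    by (subst nn_integral_indicator[symmetric], simp, subst nn_integral_distr) simp_all
  also have "\<dots> = (\<integral>\<^sup>+z. \<integral>\<^sup>+y. \<integral>\<^sup>+x. indicator A (rot c s p q (z(q := y, p := x)))
      \<partial>std_normal_distribution \<partial>std_normal_distribution \<partial>gauss K)"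
    by (rule split) measurable
  also have "\<dots> = (\<integral>\<^sup>+z. \<integral>\<^sup>+y. \<integral>\<^sup>+x. indicator A (z(q := y, p := x))
      \<partial>std_normal_distribution \<partial>std_normal_distribution \<partial>gauss K)"
  proof (rule nn_integral_cong)
    fix z assume z: "z \<in> space (gauss K)"
    define f where "f w = (indicator A (z(q := snd w, p := fst w)) :: ennreal)" for w
    have "(\<lambda>w. z(q := snd w, p := fst w)) \<in> borel \<Otimes>\<^sub>M borel \<rightarrow>\<^sub>M PiM I (\<lambda>_. borel)"
      by (rule measurable_fun_upd[where J="insert q K"], use K in blast, rule measurable_fun_upd[where J=K])
        (use z in \<open>auto simp: space_gauss space_PiM PiE_def\<close>)
    then have "(\<lambda>w. z(q := snd w, p := fst w)) \<in> borel \<Otimes>\<^sub>M borel \<rightarrow>\<^sub>M gauss I"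
      by (simp cong: measurable_cong_sets add: sets_gauss)
    then have [measurable]: "f \<in> borel_measurable (borel \<Otimes>\<^sub>M borel)" unfolding f_def by measurable
    have "rot c s p q (z(q := y, p := x)) = z(q := s * x + c * y, p := c * x - s * y)" for x y
      using I(4) by (auto simp: rot_def fun_eq_iff)
    then show "(\<integral>\<^sup>+y. \<integral>\<^sup>+x. indicator A (rot c s p q (z(q := y, p := x)))
          \<partial>std_normal_distribution \<partial>std_normal_distribution)
        = (\<integral>\<^sup>+y. \<integral>\<^sup>+x. indicator A (z(q := y, p := x)) \<partial>std_normal_distribution \<partial>std_normal_distribution)"
      using nn_integral_rotate_std_normal[of f c s] cs by (simp add: f_def)
  qed
  also have "\<dots> = (\<integral>\<^sup>+x. indicator A x \<partial>gauss I)"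
    by (rule split[symmetric]) measurable
  also have "\<dots> = emeasure (gauss I) A" by simp
  finally show "emeasure (distr (gauss I) (gauss I) (rot c s p q)) A = emeasure (gauss I) A" .
qed simp

text \<open>
  A rotation of the rows \<open>a\<close> and \<open>b\<close> of a matrix, restricted to the columns in \<open>J\<close> so that it can be
  built up one column at a time.
\<close>

definition rot_rows :: "real \<Rightarrow> real \<Rightarrow> 'r \<Rightarrow> 'r \<Rightarrow> 'c set \<Rightarrow> ('r \<times> 'c \<Rightarrow> real) \<Rightarrow> 'r \<times> 'c \<Rightarrow> real" where
  "rot_rows c s a b J g = (\<lambda>(i, j). if j \<in> J then rot c s a b (\<lambda>i. g (i, j)) i else g (i, j))"

lemma gauss_rot_rows:
  fixes a b :: 'r and J :: "'c set"
  assumes I: "finite I" "a \<noteq> b" and cs: "c\<^sup>2 + s\<^sup>2 = 1"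
    and J: "finite J" "{a, b} \<times> J \<subseteq> I"
  shows "rot_rows c s a b J \<in> gauss I \<rightarrow>\<^sub>M gauss I \<and> distr (gauss I) (gauss I) (rot_rows c s a b J) = gauss I"
  using J
proof (induction J rule: finite_induct)
  case empty
  have "rot_rows c s a b ({} :: 'c set) = (\<lambda>x. x)" by (auto simp: rot_rows_def fun_eq_iff)
  then show ?case by simp
next
  case (insert j J)
  have eq: "rot_rows c s a b (insert j J) = rot c s (a, j) (b, j) \<circ> rot_rows c s a b J"
    using insert.hyps I(2) by (auto simp: rot_rows_def rot_def fun_eq_iff)
  have m: "rot_rows c s a b J \<in> gauss I \<rightarrow>\<^sub>M gauss I"
    and d: "distr (gauss I) (gauss I) (rot_rows c s a b J) = gauss I" using insert by auto
  have m': "rot c s (a, j) (b, j) \<in> gauss I \<rightarrow>\<^sub>M gauss I"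
    using insert.prems by (intro measurable_rot) auto
  have d': "distr (gauss I) (gauss I) (rot c s (a, j) (b, j)) = gauss I"
    using insert.prems I cs by (intro gauss_rot) auto
  show ?case unfolding eq using measurable_comp[OF m m'] distr_distr[OF m' m] d d' by metis
qed

section \<open>The chi-square distribution\<close>

lemma gauss_eq_density:
  assumes "finite I"
  shows "gauss I = density (PiM I (\<lambda>_. lborel)) (\<lambda>x. ennreal (\<Prod>i\<in>I. std_normal_density (x i)))"
  unfolding gauss_def
proof (rule gauss_prod.PiM_eqI[OF assms, symmetric])
  interpret L: product_sigma_finite "\<lambda>_. lborel :: real measure" by unfold_locales
  fix A :: "_ \<Rightarrow> real set" assume A: "\<And>i. i \<in> I \<Longrightarrow> A i \<in> sets std_normal_distribution"
  then have [measurable]: "\<And>i. i \<in> I \<Longrightarrow> A i \<in> sets borel" by simp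
  have "emeasure (density (PiM I (\<lambda>_. lborel)) (\<lambda>x. ennreal (\<Prod>i\<in>I. std_normal_density (x i)))) (Pi\<^sub>E I A)
      = (\<integral>\<^sup>+x. ennreal (\<Prod>i\<in>I. std_normal_density (x i)) * indicator (Pi\<^sub>E I A) x \<partial>PiM I (\<lambda>_. lborel))"
    using assms by (intro emeasure_density) (auto intro!: sets_PiM_I_finite)
  also have "\<dots> = (\<integral>\<^sup>+x. (\<Prod>i\<in>I. ennreal (std_normal_density (x i)) * indicator (A i) (x i)) \<partial>PiM I (\<lambda>_. lborel))"
  proof (rule nn_integral_cong)
    fix x :: "_ \<Rightarrow> real" assume x: "x \<in> space (PiM I (\<lambda>_. lborel))"
    then have "indicator (Pi\<^sub>E I A) x = (\<Prod>i\<in>I. indicator (A i) (x i) :: ennreal)"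
      using assms by (auto simp: indicator_def space_PiM PiE_def Pi_def prod_zero_iff)
    then show "ennreal (\<Prod>i\<in>I. std_normal_density (x i)) * indicator (Pi\<^sub>E I A) x
      = (\<Prod>i\<in>I. ennreal (std_normal_density (x i)) * indicator (A i) (x i))"
      by (simp add: prod.distrib prod_ennreal)
  qed
  also have "\<dots> = (\<Prod>i\<in>I. \<integral>\<^sup>+y. ennreal (std_normal_density y) * indicator (A i) y \<partial>lborel)"
    by (rule L.product_nn_integral_prod) (use assms in auto)
  also have "\<dots> = (\<Prod>i\<in>I. emeasure std_normal_distribution (A i))"
    by (intro prod.cong) (auto simp: emeasure_density)
  finally show "emeasure (density (PiM I (\<lambda>_. lborel)) (\<lambda>x. ennreal (\<Prod>i\<in>I. std_normal_density (x i)))) (Pi\<^sub>E I A)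
     = (\<Prod>i\<in>I. emeasure std_normal_distribution (A i))" .
qed (use assms in \<open>auto intro!: sets_PiM_cong\<close>)

lemma prod_std_normal_density:
  "(\<Prod>i\<in>I. std_normal_density (x i)) = exp (- (\<Sum>i\<in>I. (x i)\<^sup>2) / 2) / sqrt ((2 * pi) ^ card I)"
proof (cases "finite I")
  case True
  have "(\<Prod>i\<in>I. std_normal_density (x i)) = (\<Prod>i\<in>I. 1 / sqrt (2 * pi)) * exp (\<Sum>i\<in>I. - (x i)\<^sup>2 / 2)"
    unfolding std_normal_density_def prod.distrib exp_sum[OF True] ..
  moreover have "sqrt ((2 * pi) ^ card I) = sqrt (2 * pi) ^ card I" by (rule real_sqrt_power)
  ultimately show ?thesis
    by (simp add: sum_negf sum_divide_distrib power_one_over del: real_sqrt_mult power_mult_distrib)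
qed simp

text \<open>
  A polar-coordinate formula: the ball of squared radius \<open>r\<close> has volume proportional to \<open>r powr a\<close>,
  which determines the image measure.
\<close>

lemma distr_sum_squares_lborel:
  assumes I: "finite I" "I \<noteq> {}"
  defines "a \<equiv> real (card I) / 2"
  shows "distr (PiM I (\<lambda>_. lborel)) borel (\<lambda>x. \<Sum>i\<in>I. (x i)\<^sup>2)
       = density lborel (\<lambda>t. ennreal (indicator {0..} t * (pi powr a / Gamma a * t powr (a - 1))))"
    (is "?L = ?R")
proof (rule measure_eqI_generator_eq[where \<Omega> = UNIV and E = "range atMost" and A = "\<lambda>n. {..real n}"])
  interpret L: product_sigma_finite "\<lambda>_. lborel :: real measure" by unfold_locales
  have a: "a > 0" using I by (simp add: a_def card_gt_0_iff)
  define V where "V = pi powr a / Gamma a"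
  have V: "V > 0" using a by (simp add: V_def Gamma_real_pos)
  have vol: "unit_ball_vol (real (card I)) = V / a"
    using a Gamma_plus1[of a] by (simp add: unit_ball_vol_def V_def a_def[symmetric] nonpos_Ints_def add.commute)
  show "Int_stable (range (atMost :: real \<Rightarrow> _))" by (auto simp: Int_stable_def)
  have fin: "emeasure ?L {..r} = (if r \<le> 0 then 0 else ennreal (V / a * r powr a))" for r
  proof -
    have e: "emeasure ?L {..r} = emeasure (PiM I (\<lambda>_. lborel)) ({x. (\<Sum>i\<in>I. (x i)\<^sup>2) \<le> r} \<inter> space (PiM I (\<lambda>_. lborel)))"
      by (subst emeasure_distr) (auto intro!: arg_cong2[where f=emeasure])
    show ?thesis
    proof (cases "r \<le> 0")
      case True
      \<comment> \<open>The formula for the volume of balls concerns positive radii; here the ball is empty or the origin.\<close>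
      have "{x. (\<Sum>i\<in>I. (x i)\<^sup>2) \<le> r} \<inter> space (PiM I (\<lambda>_. lborel)) \<subseteq> (PiE I (\<lambda>_. {0}))"
      proof
        fix x :: "_ \<Rightarrow> real" assume x: "x \<in> {x. (\<Sum>i\<in>I. (x i)\<^sup>2) \<le> r} \<inter> space (PiM I (\<lambda>_. lborel))"
        then have "(\<Sum>i\<in>I. (x i)\<^sup>2) = 0" using True by (intro antisym sum_nonneg) auto
        then have "\<forall>i\<in>I. x i = 0" using I by (simp add: sum_nonneg_eq_0_iff)
        then show "x \<in> PiE I (\<lambda>_. {0})" using x by (auto simp: space_PiM PiE_iff intro: extensionalityI)
      qed
      moreover have "emeasure (PiM I (\<lambda>_. lborel)) (PiE I (\<lambda>_. {0 :: real})) = 0"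
        using I by (subst L.emeasure_PiM) auto
      moreover have "PiE I (\<lambda>_. {0 :: real}) \<in> sets (PiM I (\<lambda>_. lborel))"
        using I by (intro sets_PiM_I_finite) auto
      ultimately have "emeasure ?L {..r} = 0" unfolding e
        by (metis emeasure_mono le_zero_eq)
      then show ?thesis using True by simp
    next
      case False
      then have r: "r > 0" by simp
      have "{x. (\<Sum>i\<in>I. (x i)\<^sup>2) \<le> r} = {x. sqrt (\<Sum>i\<in>I. (x i)\<^sup>2) \<le> sqrt r}" by simp
      then have "emeasure ?L {..r} = ennreal (V / a * sqrt r ^ card I)"
        unfolding e using emeasure_cball_aux[OF I(1), of "sqrt r"] r vol by simp
      also have "sqrt r ^ card I = r powr a"
        using r by (simp add: a_def powr_half_sqrt[symmetric] powr_realpow[symmetric] powr_powr)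
      finally show ?thesis using False by simp
    qed
  qed
  show "\<And>n. emeasure ?L {..real n} \<noteq> \<infinity>" by (simp add: fin)
  show "emeasure ?L X = emeasure ?R X" if "X \<in> range atMost" for X
  proof -
    from that obtain r where X: "X = {..r}" by auto
    have R: "emeasure ?R {..r} = (\<integral>\<^sup>+t. ennreal (indicator {0..} t * (V * t powr (a - 1))) * indicator {..r} t \<partial>lborel)"
      unfolding V_def by (rule emeasure_density) auto
    show ?thesis
    proof (cases "r \<le> 0")
      case True
      have "emeasure ?R {..r} = (\<integral>\<^sup>+t. 0 \<partial>(lborel :: real measure))" unfolding R
        by (rule nn_integral_cong_AE, rule AE_I'[of "{0}"]) (use True in \<open>auto simp: indicator_def\<close>)
      then show ?thesis using True by (simp add: X fin)
    next
      case False
      have hi: "((\<lambda>t. V * t powr (a - 1)) has_integral V * (r powr a / a)) {0..r}"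
        using has_integral_powr_from_0[of "a - 1" r] a False by (intro has_integral_mult_right) auto
      have "emeasure ?R {..r} = (\<integral>\<^sup>+t. ennreal (V * t powr (a - 1) * indicator {0..r} t) \<partial>lborel)"
        unfolding R by (intro nn_integral_cong) (auto simp: indicator_def)
      also have "\<dots> = ennreal (V * (r powr a / a))"
        using nn_integral_has_integral_lebesgue[OF _ hi] V by (simp add: mult.commute)
      finally show ?thesis using False by (simp add: X fin)
    qed
  qed
  show "(\<Union>i. {..real i}) = UNIV" by (auto simp: real_arch_simple)
  show "range (\<lambda>n. {..real n}) \<subseteq> range atMost" by auto
qed (auto simp: borel_eq_atMost)

lemma distr_sum_squares_gauss:
  assumes I: "finite I" "I \<noteq> {}"
  defines "a \<equiv> real (card I) / 2"
  shows "distr (gauss I) borel (\<lambda>x. \<Sum>i\<in>I. (x i)\<^sup>2)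
       = density lborel (\<lambda>t. ennreal (indicator {0..} t * (t powr (a - 1) * exp (- t / 2) / (2 powr a * Gamma a))))"
proof -
  have a: "a > 0" using I by (simp add: a_def card_gt_0_iff)
  define c where "c = sqrt ((2 * pi) ^ card I)"
  have "(2 * pi) ^ card I = (2 * pi) powr real (card I)" by (rule powr_realpow[symmetric]) simp
  then have c: "c = (2 * pi) powr a" unfolding c_def a_def
    by (subst powr_half_sqrt[symmetric]) (simp_all only: powr_powr, simp_all)
  have "distr (gauss I) borel (\<lambda>x. \<Sum>i\<in>I. (x i)\<^sup>2)
     = density (distr (PiM I (\<lambda>_. lborel)) borel (\<lambda>x. \<Sum>i\<in>I. (x i)\<^sup>2)) (\<lambda>t. ennreal (exp (- t / 2) / c))"
    unfolding gauss_eq_density[OF I(1)] prod_std_normal_density c_def[symmetric]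
    by (rule density_distr[symmetric]) auto
  also have "\<dots> = density lborel (\<lambda>t. ennreal (indicator {0..} t * (pi powr a / Gamma a * t powr (a - 1)))
        * ennreal (exp (- t / 2) / c))"
    unfolding distr_sum_squares_lborel[OF I] a_def[symmetric]
    by (rule density_density_eq) auto
  also have "(\<lambda>t. ennreal (indicator {0..} t * (pi powr a / Gamma a * t powr (a - 1)))
        * ennreal (exp (- t / 2) / c))
     = (\<lambda>t. ennreal (indicator {0..} t * (t powr (a - 1) * exp (- t / 2) / (2 powr a * Gamma a))))"
    using a by (auto simp: fun_eq_iff c powr_mult ennreal_mult'[symmetric] indicator_def field_simps)
  finally show ?thesis .
qed

text \<open>
  The power \<open>x powr (\<i> s)\<close> for positive \<open>x\<close>. With the value \<open>0\<close> at \<open>0\<close> it is multiplicative on all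
  nonnegative reals, so singular matrices need no separate treatment, and \<open>s = 0\<close> gives the indicator
  of the positive reals, through which the same formulas show that a determinant is almost surely
  nonzero.
\<close>

definition imag_power :: "real \<Rightarrow> real \<Rightarrow> complex" where
  "imag_power s x = (if x > 0 then exp (\<i> * of_real (s * ln x)) else 0)"

lemma imag_power_mult: "x \<ge> 0 \<Longrightarrow> y \<ge> 0 \<Longrightarrow> imag_power s (x * y) = imag_power s x * imag_power s y"
  by (auto simp: imag_power_def ln_mult_pos zero_less_mult_iff ring_distribs exp_add)

lemma norm_imag_power_le: "cmod (imag_power s x) \<le> 1"
  by (simp add: imag_power_def)

lemma measurable_imag_power[measurable]: "imag_power s \<in> borel_measurable borel"
  unfolding imag_power_def by measurable

text \<open>
  The sum of squares has the chi-square density, and after the substitution \<open>t = 2 u\<close> the integral is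
  Euler's integral for the gamma function at \<open>card I / 2 + \<i> s\<close>.
\<close>

lemma integral_imag_power_sum_squares:
  assumes I: "finite I" "I \<noteq> {}"
  shows "(\<integral>x. imag_power s (\<Sum>i\<in>I. (x i)\<^sup>2) \<partial>gauss I) = chi_square_mellin (card I) s"
proof -
  define a where "a = real (card I) / 2"
  have a: "a > 0" using I by (simp add: a_def card_gt_0_iff)
  define z where "z = complex_of_real a + \<i> * of_real s"
  have z: "Re z > 0" using a by (simp add: z_def)
  let ?G = "\<lambda>t. complex_of_real t powr (z - 1) / of_real (exp t)"
  have ai: "?G absolutely_integrable_on {0<..}" by (rule absolutely_integrable_Gamma_integral'[OF z])
  have "(\<integral>t. indicator {0<..} t *\<^sub>R ?G t \<partial>lebesgue) = Gamma z"
    using set_lebesgue_integral_eq_integral(2)[OF ai] integral_unique[OF Gamma_integral_complex'[OF z]]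
    by (simp add: set_lebesgue_integral_def)
  then have G: "(\<integral>t. indicator {0<..} t *\<^sub>R ?G t \<partial>lborel) = Gamma z"
    proof (subst (asm) integral_completion)
    show "(\<lambda>t. indicator {0<..} t *\<^sub>R ?G t) \<in> borel_measurable lborel"
      unfolding measurable_lborel2
      by (intro borel_measurable_continuous_on_indicator continuous_intros)
         (auto simp: complex_nonpos_Reals_iff)
  qed
  have "(\<integral>x. imag_power s (\<Sum>i\<in>I. (x i)\<^sup>2) \<partial>gauss I) = (\<integral>t. imag_power s t \<partial>distr (gauss I) borel (\<lambda>x. \<Sum>i\<in>I. (x i)\<^sup>2))"
    by (subst integral_distr) auto
  also have "\<dots> = (\<integral>t. (indicator {0..} t * (t powr (a - 1) * exp (- t / 2) / (2 powr a * Gamma a))) *\<^sub>R imag_power s t \<partial>lborel)"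
    unfolding distr_sum_squares_gauss[OF I] a_def[symmetric]
    using a by (subst integral_density) (auto simp: Gamma_real_pos less_imp_le)
  also have "\<dots> = 2 *\<^sub>R (\<integral>t. (indicator {0..} (2*t) * ((2*t) powr (a - 1) * exp (- t) / (2 powr a * Gamma a))) *\<^sub>R imag_power s (2*t) \<partial>lborel)"
    by (subst lborel_integral_real_affine[of 2 _ 0]) simp_all
  also have "\<dots> = 2 *\<^sub>R (\<integral>t. (exp (\<i> * of_real (s * ln 2)) / of_real (2 * Gamma a)) * (indicator {0<..} t *\<^sub>R ?G t) \<partial>lborel)"
  proof (intro arg_cong[where f="\<lambda>x. 2 *\<^sub>R x"] Bochner_Integration.integral_cong refl)
    fix t :: real
    show "(indicator {0..} (2*t) * ((2*t) powr (a - 1) * exp (- t) / (2 powr a * Gamma a))) *\<^sub>R imag_power s (2*t)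
      = (exp (\<i> * of_real (s * ln 2)) / of_real (2 * Gamma a)) * (indicator {0<..} t *\<^sub>R ?G t)"
    proof (cases "t > 0")
      case True
      have "complex_of_real t powr (z - 1) = exp ((z - 1) * of_real (ln t))"
        using True by (simp add: powr_def Ln_of_real)
      also have "\<dots> = of_real (t powr (a - 1)) * exp (\<i> * of_real (s * ln t))"
        using True by (simp add: powr_def z_def exp_of_real[symmetric] exp_add[symmetric] algebra_simps)
      finally have 1: "complex_of_real t powr (z - 1) = of_real (t powr (a - 1)) * exp (\<i> * of_real (s * ln t))" .
      have 2: "imag_power s (2*t) = exp (\<i> * of_real (s * ln 2)) * exp (\<i> * of_real (s * ln t))"
        using True by (simp add: imag_power_def ln_mult_pos exp_add[symmetric] algebra_simps)
      have 3: "(2*t) powr (a - 1) / 2 powr a = t powr (a - 1) / 2"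
        using True by (simp add: powr_mult powr_diff)
      have "(indicator {0..} (2*t) * ((2*t) powr (a - 1) * exp (- t) / (2 powr a * Gamma a)))
         = ((2*t) powr (a - 1) / 2 powr a) * exp (- t) / Gamma a" using True by simp
      also have "\<dots> = t powr (a - 1) / (2 * Gamma a * exp t)" unfolding 3 by (simp add: exp_minus field_simps)
      finally show ?thesis using True unfolding 1 2 by (simp add: scaleR_conv_of_real)
    qed (auto simp: imag_power_def indicator_def)
  qed
  also have "\<dots> = exp (\<i> * of_real (s * ln 2)) / of_real (Gamma a) * Gamma z"
    using G by (subst integral_mult_right_zero) (simp add: scaleR_conv_of_real)
  also have "\<dots> = chi_square_mellin (card I) s"
  proof -
    have "z \<notin> \<int>\<^sub>\<le>\<^sub>0" using z by (auto elim!: nonpos_Ints_cases)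
    then have "Gamma z = exp (ln_Gamma z)" by (simp add: Gamma_complex_altdef)
    moreover have "complex_of_real (Gamma a) = exp (of_real (ln_Gamma a))"
      using a by (simp add: Gamma_real_pos_exp exp_of_real)
    ultimately show ?thesis
      by (simp add: chi_square_mellin_def a_def[symmetric] z_def[symmetric] exp_add exp_diff)
  qed
  finally show ?thesis .
qed

section \<open>Determinants of bordered Gaussian matrices\<close>

lemma measurable_det:
  assumes "\<And>i j. i < n \<Longrightarrow> j < n \<Longrightarrow> (\<lambda>\<omega>. f \<omega> i j) \<in> borel_measurable M"
  shows "(\<lambda>\<omega>. Determinant.det (Matrix.mat n n (\<lambda>(i, j). f \<omega> i j)) :: real) \<in> borel_measurable M"
proof -
  have "Determinant.det (Matrix.mat n n (\<lambda>(i, j). f \<omega> i j))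
     = (\<Sum>p | p permutes {0..<n}. signof p * (\<Prod>i=0..<n. f \<omega> i (p i)))" for \<omega>
    by (subst det_def'[of _ n]) (auto intro!: sum.cong prod.cong simp: permutes_in_image)
  then show ?thesis
    using assms by (auto intro!: borel_measurable_sum borel_measurable_times borel_measurable_prod
        simp: permutes_in_image)
qed

text \<open>
  A square matrix with first column \<open>u\<close> and the remaining columns taken from \<open>g\<close>. The offsets \<open>r\<close> and
  \<open>q\<close> let a minor of such a matrix be read off the same function \<open>g\<close>, so that the induction below
  needs no reindexing of the Gaussian measure.
\<close>

definition bordered :: "nat \<Rightarrow> nat \<Rightarrow> nat \<Rightarrow> (nat \<Rightarrow> real) \<Rightarrow> (nat \<times> nat \<Rightarrow> real) \<Rightarrow> real mat" where
  "bordered n r q u g = Matrix.mat (Suc n) (Suc n)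
     (\<lambda>(i, j). case j of 0 \<Rightarrow> u (r + i) | Suc k \<Rightarrow> g (r + i, q + k))"

lemma bordered_carrier[simp]: "bordered n r q u g \<in> carrier_mat (Suc n) (Suc n)"
  by (simp add: bordered_def)

text \<open>
  The Gram determinant of the columns: the squared determinant depends only on the scalar products of
  columns, hence is invariant under rotations of the rows.
\<close>

lemma det_bordered_power2:
  "(Determinant.det (bordered n r q u g))\<^sup>2 = Determinant.det (Matrix.mat (Suc n) (Suc n) (\<lambda>(j, k).
     \<Sum>i\<in>{r..r+n}. (case j of 0 \<Rightarrow> u i | Suc j \<Rightarrow> g (i, q + j)) * (case k of 0 \<Rightarrow> u i | Suc k \<Rightarrow> g (i, q + k))))"
    (is "_ = Determinant.det ?G")
proof -
  let ?A = "bordered n r q u g"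
  have "transpose_mat ?A * ?A = ?G"
  proof (rule eq_matI)
    fix j k assume "j < dim_row ?G" "k < dim_col ?G"
    then have jk: "j < Suc n" "k < Suc n" by auto
    have "(transpose_mat ?A * ?A) $$ (j, k) = (\<Sum>i=0..<Suc n. (case j of 0 \<Rightarrow> u (r + i) | Suc j \<Rightarrow> g (r + i, q + j)) *
        (case k of 0 \<Rightarrow> u (r + i) | Suc k \<Rightarrow> g (r + i, q + k)))"
      using jk by (simp add: bordered_def scalar_prod_def)
    also have "\<dots> = (\<Sum>i\<in>{r..r+n}. (case j of 0 \<Rightarrow> u i | Suc j \<Rightarrow> g (i, q + j)) * (case k of 0 \<Rightarrow> u i | Suc k \<Rightarrow> g (i, q + k)))"
      by (rule sum.reindex_bij_witness[of _ "\<lambda>i. i - r" "\<lambda>i. r + i"]) auto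
    finally show "(transpose_mat ?A * ?A) $$ (j, k) = ?G $$ (j, k)" using jk by simp
  qed (auto simp: bordered_def)
  then show ?thesis
    using det_mult[of "transpose_mat ?A" "Suc n" ?A] det_transpose[of ?A "Suc n"]
    by (simp add: power2_eq_square)
qed

lemma sum_mult_rot:
  assumes "finite S" "a \<in> S" "b \<in> S" "a \<noteq> b" "c\<^sup>2 + s\<^sup>2 = (1 :: real)"
  shows "(\<Sum>i\<in>S. rot c s a b x i * rot c s a b y i) = (\<Sum>i\<in>S. x i * y i)"
proof -
  have S: "S = insert a (insert b (S - {a, b}))" using assms by auto
  have split: "(\<Sum>i\<in>S. f i) = f a + f b + (\<Sum>i\<in>S - {a, b}. f i)" for f :: "_ \<Rightarrow> real"
    using assms by (subst S, subst sum.insert) auto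
  have "(\<Sum>i\<in>S - {a, b}. rot c s a b x i * rot c s a b y i) = (\<Sum>i\<in>S - {a, b}. x i * y i)"
    by (rule sum.cong) (auto simp: rot_def)
  moreover have "rot c s a b x a * rot c s a b y a + rot c s a b x b * rot c s a b y b
      = (c\<^sup>2 + s\<^sup>2) * (x a * y a + x b * y b)"
    using \<open>a \<noteq> b\<close> by (simp add: rot_def power2_eq_square algebra_simps)
  ultimately show ?thesis using assms(5) by (simp add: split)
qed

lemma det_bordered_rot:
  assumes "a \<in> {r..r+n}" "b \<in> {r..r+n}" "a \<noteq> b" "c\<^sup>2 + s\<^sup>2 = 1"
  shows "(Determinant.det (bordered n r q (rot c s a b u) (rot_rows c s a b {q..<q+n} g)))\<^sup>2
       = (Determinant.det (bordered n r q u g))\<^sup>2"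
proof -
  have col: "(case j of 0 \<Rightarrow> rot c s a b u i | Suc j \<Rightarrow> rot_rows c s a b {q..<q+n} g (i, q + j))
     = rot c s a b (\<lambda>i. case j of 0 \<Rightarrow> u i | Suc j \<Rightarrow> g (i, q + j)) i" if "j < Suc n" for i j
    using that by (cases j) (auto simp: rot_rows_def)
  show ?thesis unfolding det_bordered_power2
    by (intro arg_cong[where f = Determinant.det] cong_mat refl)
       (simp add: col sum_mult_rot[OF _ assms])
qed

lemma bordered_cong:
  assumes "\<And>i. i \<in> {r..r+n} \<Longrightarrow> u i = u' i"
    and "\<And>i j. i \<in> {r..r+n} \<Longrightarrow> j \<in> {q..<q+n} \<Longrightarrow> g (i, j) = g' (i, j)"
  shows "bordered n r q u g = bordered n r q u' g'"
  unfolding bordered_def using assms by (intro cong_mat) (auto split: nat.split)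

lemma det_bordered_axis:
  assumes "\<And>i. i \<in> {Suc r..r + Suc n} \<Longrightarrow> u i = 0"
  shows "Determinant.det (bordered (Suc n) r q u g)
       = u r * Determinant.det (bordered n (Suc r) (Suc q) (\<lambda>i. g (i, q)) g)"
proof -
  let ?A = "bordered (Suc n) r q u g"
  have "Determinant.det ?A = (\<Sum>i<Suc (Suc n). ?A $$ (i, 0) * cofactor ?A i 0)"
    by (rule laplace_expansion_column) auto
  also have "\<dots> = (\<Sum>i<Suc (Suc n). if i = 0 then ?A $$ (0, 0) * cofactor ?A 0 0 else 0)"
    using assms by (intro sum.cong) (auto simp: bordered_def)
  also have "\<dots> = u r * cofactor ?A 0 0" by (simp add: bordered_def)
  also have "cofactor ?A 0 0 = Determinant.det (bordered n (Suc r) (Suc q) (\<lambda>i. g (i, q)) g)"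
    unfolding cofactor_def mat_delete_def
    by (simp, intro arg_cong[where f = Determinant.det] eq_matI)
       (auto simp: bordered_def split: nat.split)
  finally show ?thesis .
qed

lemma measurable_det_bordered:
  assumes "{r..r+n} \<times> {q..<q+n} \<subseteq> I"
    and "\<And>i. i \<in> {r..r+n} \<Longrightarrow> (\<lambda>g. U g i) \<in> borel_measurable (gauss I)"
  shows "(\<lambda>g. Determinant.det (bordered n r q (U g) g)) \<in> borel_measurable (gauss I)"
  unfolding bordered_def
proof (rule measurable_det)
  fix i j assume ij: "i < Suc n" "j < Suc n"
  show "(\<lambda>g. case j of 0 \<Rightarrow> U g (r + i) | Suc k \<Rightarrow> g (r + i, q + k)) \<in> borel_measurable (gauss I)"
  proof (cases j)
    case 0
    then show ?thesis using assms(2)[of "r + i"] ij by simp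
  next
    case (Suc k)
    then have "(r + i, q + k) \<in> I" using assms(1) ij by auto
    then show ?thesis using Suc by (simp cong: measurable_cong_sets add: sets_gauss)
  qed
qed

text \<open>
  The Mellin transform, on the imaginary axis, of the squared determinant of a bordered standard Gaussian
  matrix.
\<close>

definition border_mellin :: "real \<Rightarrow> nat \<Rightarrow> nat \<Rightarrow> nat \<Rightarrow> (nat \<Rightarrow> real) \<Rightarrow> complex" where
  "border_mellin s n r q u =
     (\<integral>g. imag_power s ((Determinant.det (bordered n r q u g))\<^sup>2) \<partial>gauss ({r..r+n} \<times> {q..<q+n}))"

text \<open>
  Rotating all columns leaves the squared determinant unchanged, and rotating the Gaussian columns leaves
  their law unchanged; so rotating the first column alone has no effect on the expectation.
\<close>

lemma border_mellin_rot:
  assumes ab: "a \<in> {r..r+n}" "b \<in> {r..r+n}" "a \<noteq> b" and cs: "c\<^sup>2 + d\<^sup>2 = 1"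
  shows "border_mellin s n r q (rot c d a b u) = border_mellin s n r q u"
proof -
  let ?I = "{r..r+n} \<times> {q..<q+n}"
  have sub: "{a, b} \<times> {q..<q+n} \<subseteq> ?I" using ab by auto
  have T: "rot_rows c d a b {q..<q+n} \<in> gauss ?I \<rightarrow>\<^sub>M gauss ?I"
      "distr (gauss ?I) (gauss ?I) (rot_rows c d a b {q..<q+n}) = gauss ?I"
    using gauss_rot_rows[OF _ ab(3) cs _ sub] by simp_all
  have "border_mellin s n r q (rot c d a b u) = (\<integral>g. imag_power s ((Determinant.det
     (bordered n r q (rot c d a b u) (rot_rows c d a b {q..<q+n} g)))\<^sup>2) \<partial>gauss ?I)"
    unfolding border_mellin_def
    by (subst T(2)[symmetric], subst integral_distr[OF T(1)])
       (auto intro!: measurable_compose[OF _ measurable_imag_power] borel_measurable_power measurable_det_bordered)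
  also have "\<dots> = border_mellin s n r q u"
    unfolding border_mellin_def det_bordered_rot[OF ab cs] ..
  finally show ?thesis .
qed

text \<open>
  Plane rotations through row \<open>r\<close> move the entries of the first column into row \<open>r\<close>, one at a time,
  until the column is a multiple of a coordinate vector of the same length.
\<close>

lemma border_mellin_clear:
  assumes "finite B" "B \<subseteq> {Suc r..r+n}"
  shows "\<exists>v. (v r)\<^sup>2 = (u r)\<^sup>2 + (\<Sum>i\<in>B. (u i)\<^sup>2) \<and> (\<forall>i\<in>B. v i = 0) \<and> (\<forall>i. i \<noteq> r \<longrightarrow> i \<notin> B \<longrightarrow> v i = u i)
     \<and> border_mellin s n r q u = border_mellin s n r q v"
  using assms
proof (induction B rule: finite_induct)
  case empty
  show ?case by (rule exI[of _ u]) simp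
next
  case (insert b B)
  then obtain v where v: "(v r)\<^sup>2 = (u r)\<^sup>2 + (\<Sum>i\<in>B. (u i)\<^sup>2)" "\<forall>i\<in>B. v i = 0"
    "\<forall>i. i \<noteq> r \<longrightarrow> i \<notin> B \<longrightarrow> v i = u i" "border_mellin s n r q u = border_mellin s n r q v" by auto
  have b: "b \<noteq> r" "b \<notin> B" "v b = u b" using insert v by auto
  define \<rho> where "\<rho> = sqrt ((v r)\<^sup>2 + (v b)\<^sup>2)"
  have rho2: "\<rho>\<^sup>2 = (v r)\<^sup>2 + (v b)\<^sup>2" by (simp add: \<rho>_def)
  have B: "r \<notin> B" using insert.prems by auto
  show ?case
  proof (cases "\<rho> = 0")
    case True
    then have "v b = 0" using rho2 by (auto simp: power2_eq_square sum_power2_eq_zero_iff)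
    then show ?thesis using v b insert.hyps by (intro exI[of _ v]) auto
  next
    case False
    \<comment> \<open>The rotation that takes the pair of entries (v r, v b) to (\<rho>, 0).\<close>
    define w where "w = rot (v r / \<rho>) (- v b / \<rho>) r b v"
    have cs: "(v r / \<rho>)\<^sup>2 + (- v b / \<rho>)\<^sup>2 = 1"
      using False by (simp add: power_divide rho2[symmetric] add_divide_distrib[symmetric])
    have "w r = ((v r)\<^sup>2 + (v b)\<^sup>2) / \<rho>" using b
      by (simp add: w_def rot_def power2_eq_square add_divide_distrib)
    then have "w r = \<rho>" using False unfolding rho2[symmetric] by (simp add: power2_eq_square)
    moreover have "w b = 0" by (simp add: w_def rot_def)
    moreover have wv: "w i = v i" if "i \<noteq> r" "i \<noteq> b" for i using that by (simp add: w_def rot_def)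
    moreover have "w i = 0" if "i \<in> B" for i
      using wv[of i] v(2) that b(2) B by (cases "i = b \<or> i = r") auto
    moreover have "border_mellin s n r q w = border_mellin s n r q v"
      unfolding w_def using cs b insert.prems by (intro border_mellin_rot) auto
    ultimately show ?thesis using v b insert.hyps B
      by (intro exI[of _ w]) (auto simp: rho2)
  qed
qed

lemma integrable_imag_power:
  assumes "f \<in> borel_measurable (gauss I)"
  shows "integrable (gauss I) (\<lambda>g. imag_power s (f g))"
proof -
  interpret prob_space "gauss I" by (rule prob_space_gauss)
  show ?thesis
    by (rule integrable_const_bound[of _ 1]) (use assms in \<open>auto simp: norm_imag_power_le\<close>)
qed

text \<open>
  Once the first column is a multiple of the coordinate vector of row \<open>r\<close>, its squared length splits off
  and the minor left over is a fully Gaussian square matrix of size \<open>n\<close>. Conditionally on the first column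
  of this minor, it is a bordered matrix of the next smaller size; and the squared length of that column has
  the chi-square distribution with \<open>n\<close> degrees of freedom. In this way the squared determinant is
  distributed as the squared length of \<open>u\<close> times a product of independent chi-square variables with
  \<open>n, n - 1, \<dots>, 1\<close> degrees of freedom.
\<close>

theorem border_mellin_eq:
  "border_mellin s n r q u = imag_power s (\<Sum>i\<in>{r..r+n}. (u i)\<^sup>2) * (\<Prod>k=1..n. chi_square_mellin k s)"
proof (induction n arbitrary: r q u)
  case 0
  interpret prob_space "gauss ({r..r} \<times> {q..<q})" by (rule prob_space_gauss)
  have "Determinant.det (bordered 0 r q u g) = u r" for g
    by (subst det_single) (auto simp: bordered_def)
  then show ?case by (simp add: border_mellin_def prob_space[simplified])
next
  case (Suc m)
  obtain v where v: "(v r)\<^sup>2 = (u r)\<^sup>2 + (\<Sum>i\<in>{Suc r..r + Suc m}. (u i)\<^sup>2)"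
      "\<forall>i\<in>{Suc r..r + Suc m}. v i = 0"
      "border_mellin s (Suc m) r q u = border_mellin s (Suc m) r q v"
    using border_mellin_clear[of "{Suc r..r + Suc m}" r "Suc m" u s q] by auto
  have vr: "(v r)\<^sup>2 = (\<Sum>i\<in>{r..r + Suc m}. (u i)\<^sup>2)"
    unfolding v(1) by (subst (2) sum.atLeast_Suc_atMost) auto
  \<comment> \<open>I1 carries the new border, I2 the smaller Gaussian block, and I3 the row that drops out.\<close>
  define I1 where "I1 = {Suc r..Suc r+m} \<times> {q}"
  define I2 where "I2 = {Suc r..Suc r+m} \<times> {Suc q..<Suc q+m}"
  define I3 where "I3 = {r} \<times> {q..<q + Suc m}"
  have fin: "finite I1" "finite I2" "finite I3" by (auto simp: I1_def I2_def I3_def)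
  have I: "{r..r + Suc m} \<times> {q..<q + Suc m} = (I1 \<union> I2) \<union> I3" by (auto simp: I1_def I2_def I3_def)
  define D where "D g = (Determinant.det (bordered m (Suc r) (Suc q) (\<lambda>i. g (i, q)) g))\<^sup>2" for g
  have D_cong: "D g = D g'" if "\<And>p. p \<in> I1 \<union> I2 \<Longrightarrow> g p = g' p" for g g'
    unfolding D_def using that by (subst bordered_cong[of "Suc r" m _ "\<lambda>i. g' (i, q)" "Suc q" g g'])
      (auto simp: I1_def I2_def)
  have mD: "D \<in> borel_measurable (gauss J)" if "I1 \<union> I2 \<subseteq> J" for J
    unfolding D_def using that
    by (intro borel_measurable_power measurable_det_bordered)
       (auto simp: I1_def I2_def sets_gauss cong: measurable_cong_sets intro!: measurable_component_singleton)
  have "border_mellin s (Suc m) r q v = (\<integral>g. imag_power s ((v r)\<^sup>2 * D g) \<partial>gauss ((I1 \<union> I2) \<union> I3))"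
    unfolding border_mellin_def I D_def using v(2)
    by (subst det_bordered_axis) (auto simp: power_mult_distrib)
  also have "\<dots> = (\<integral>g. imag_power s ((v r)\<^sup>2) * imag_power s (D g) \<partial>gauss ((I1 \<union> I2) \<union> I3))"
    by (intro Bochner_Integration.integral_cong refl imag_power_mult) (auto simp: D_def)
  also have "\<dots> = imag_power s ((v r)\<^sup>2) * (\<integral>g. imag_power s (D g) \<partial>gauss ((I1 \<union> I2) \<union> I3))"
    by simp
  also have "(\<integral>g. imag_power s (D g) \<partial>gauss ((I1 \<union> I2) \<union> I3)) = (\<integral>g. imag_power s (D g) \<partial>gauss (I1 \<union> I2))"
  proof -
    interpret prob_space "gauss I3" by (rule prob_space_gauss)
    have "(\<integral>g. imag_power s (D g) \<partial>gauss ((I1 \<union> I2) \<union> I3))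
       = (\<integral>x. \<integral>y. imag_power s (D (merge (I1 \<union> I2) I3 (x, y))) \<partial>gauss I3 \<partial>gauss (I1 \<union> I2))"
      unfolding gauss_def
      by (rule gauss_prod.product_integral_fold)
         (use fin integrable_imag_power[OF mD, of "(I1 \<union> I2) \<union> I3"] in
           \<open>auto simp: gauss_def I1_def I2_def I3_def\<close>)
    also have "\<dots> = (\<integral>x. \<integral>y. imag_power s (D x) \<partial>gauss I3 \<partial>gauss (I1 \<union> I2))"
      by (intro Bochner_Integration.integral_cong refl arg_cong[where f = "imag_power s"] D_cong)
         (auto simp: merge_def)
    finally show ?thesis by (simp add: prob_space)
  qed
  also have "\<dots> = (\<integral>x. \<integral>y. imag_power s (D (merge I1 I2 (x, y))) \<partial>gauss I2 \<partial>gauss I1)"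
    unfolding gauss_def
    by (rule gauss_prod.product_integral_fold)
         (use fin integrable_imag_power[OF mD, of "I1 \<union> I2"] in
           \<open>auto simp: gauss_def I1_def I2_def I3_def\<close>)
  also have "\<dots> = (\<integral>x. border_mellin s m (Suc r) (Suc q) (\<lambda>i. x (i, q)) \<partial>gauss I1)"
    unfolding border_mellin_def I2_def[symmetric] D_def
  proof (intro Bochner_Integration.integral_cong refl)
    fix x y
    show "imag_power s ((Determinant.det (bordered m (Suc r) (Suc q) (\<lambda>i. merge I1 I2 (x, y) (i, q)) (merge I1 I2 (x, y))))\<^sup>2)
       = imag_power s ((Determinant.det (bordered m (Suc r) (Suc q) (\<lambda>i. x (i, q)) y))\<^sup>2)"
      by (subst bordered_cong[of "Suc r" m _ "\<lambda>i. x (i, q)" "Suc q" _ y])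
         (auto simp: I1_def I2_def merge_def)
  qed
  also have "\<dots> = (\<integral>x. imag_power s (\<Sum>p\<in>I1. (x p)\<^sup>2) * (\<Prod>k=1..m. chi_square_mellin k s) \<partial>gauss I1)"
  proof -
    have "(\<Sum>i\<in>{Suc r..Suc r + m}. (x (i, q))\<^sup>2) = (\<Sum>p\<in>I1. (x p)\<^sup>2)" for x :: "nat \<times> nat \<Rightarrow> real"
      by (rule sum.reindex_bij_witness[of _ fst "\<lambda>i. (i, q)"]) (auto simp: I1_def)
    then show ?thesis unfolding Suc.IH by (simp only:)
  qed
  also have "\<dots> = chi_square_mellin (card I1) s * (\<Prod>k=1..m. chi_square_mellin k s)"
    using integral_imag_power_sum_squares[of I1 s] by (simp add: fin) (simp add: I1_def)
  also have "card I1 = Suc m" by (simp add: I1_def card_cartesian_product)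
  finally show ?case unfolding v(3) vr[symmetric] by (simp add: mult_ac)
qed

section \<open>Whitening a multivariate normal vector\<close>

text \<open>
  Completing the square in the last variable: \<open>Q p p\<close> is positive, and the Schur complement is again
  positive definite.
\<close>

lemma cholesky:
  fixes Q :: "nat \<Rightarrow> nat \<Rightarrow> real"
  assumes "\<And>j k. j < p \<Longrightarrow> k < p \<Longrightarrow> Q j k = Q k j"
    and "\<And>v. (\<exists>i<p. v i \<noteq> 0) \<Longrightarrow> (\<Sum>j<p. \<Sum>k<p. Q j k * v j * v k) > 0"
  shows "\<exists>m. (\<forall>i j. i < j \<longrightarrow> m i j = 0) \<and> (\<forall>i<p. m i i > 0) \<and>
             (\<forall>j<p. \<forall>k<p. Q j k = (\<Sum>i<p. m i j * m i k))"
  using assms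
proof (induction p arbitrary: Q)
  case 0
  show ?case by (rule exI[of _ "\<lambda>_ _. 0"]) auto
next
  case (Suc p)
  define r where "r = Q p p"
  have expand: "(\<Sum>j<Suc p. \<Sum>k<Suc p. Q j k * v j * v k) =
    (\<Sum>j<p. \<Sum>k<p. Q j k * v j * v k) + 2 * v p * (\<Sum>j<p. Q p j * v j) + r * (v p)\<^sup>2" for v
  proof -
    have "(\<Sum>j<p. Q j p * v j * v p) = v p * (\<Sum>j<p. Q p j * v j)"
      unfolding sum_distrib_left by (intro sum.cong) (auto simp: Suc.prems(1)[of _ p])
    moreover have "(\<Sum>k<p. Q p k * v p * v k) = v p * (\<Sum>j<p. Q p j * v j)"
      unfolding sum_distrib_left by (intro sum.cong) auto
    ultimately show ?thesis by (simp add: sum.distrib r_def power2_eq_square)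
  qed
  have r: "r > 0" using Suc.prems(2)[of "\<lambda>i. if i = p then 1 else 0"] unfolding expand by auto
  define Q' where "Q' j k = Q j k - Q p j * Q p k / r" for j k
  have "(\<Sum>j<p. \<Sum>k<p. Q' j k * v j * v k) > 0" if v: "\<exists>i<p. v i \<noteq> 0" for v
  proof -
    define S where "S = (\<Sum>j<p. Q p j * v j)"
    \<comment> \<open>The value of the last coordinate that minimises the quadratic form.\<close>
    define w where "w = v(p := - S / r)"
    have wv: "w j = v j" if "j < p" for j using that by (simp add: w_def)
    have "(\<Sum>j<p. \<Sum>k<p. Q p j * Q p k / r * v j * v k) = S * S / r"
      unfolding S_def sum_product sum_divide_distrib by (intro sum.cong) auto
    then have "(\<Sum>j<p. \<Sum>k<p. Q' j k * v j * v k) = (\<Sum>j<p. \<Sum>k<p. Q j k * v j * v k) - S\<^sup>2 / r"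
      by (simp add: Q'_def left_diff_distrib sum_subtractf power2_eq_square)
    also have "\<dots> = (\<Sum>j<Suc p. \<Sum>k<Suc p. Q j k * w j * w k)"
      unfolding expand using r
      by (simp add: wv S_def[symmetric]) (simp add: w_def field_simps power2_eq_square)
    also have "\<dots> > 0" using v wv by (intro Suc.prems(2)) (metis less_SucI)
    finally show ?thesis .
  qed
  moreover have "Q' j k = Q' k j" if "j < p" "k < p" for j k
    using that Suc.prems(1)[of j k] by (simp add: Q'_def)
  ultimately obtain m where m: "\<forall>i j. i < j \<longrightarrow> m i j = 0" "\<forall>i<p. m i i > 0"
    "\<forall>j<p. \<forall>k<p. Q' j k = (\<Sum>i<p. m i j * m i k)" using Suc.IH[of Q'] by blast
  define m' where "m' i j = (if i < p then m i j else if i < j then 0 else Q p j / sqrt r)" for i j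
  have "Q j k = (\<Sum>i<Suc p. m' i j * m' i k)" if jk: "j < Suc p" "k < Suc p" for j k
  proof -
    have *: "(\<Sum>i<Suc p. m' i j * m' i k) = (\<Sum>i<p. m i j * m i k) + Q p j * Q p k / r"
      using jk r by (simp add: m'_def)
    show ?thesis
    proof (cases "j < p \<and> k < p")
      case True
      then show ?thesis unfolding * using m(3) by (metis Q'_def diff_add_cancel)
    next
      case False
      then have "j = p \<or> k = p" using jk by auto
      moreover have "(\<Sum>i<p. m i j * m i k) = 0"
        using m(1) \<open>j = p \<or> k = p\<close> by (intro sum.neutral) auto
      ultimately show ?thesis unfolding * using r jk Suc.prems(1)[of j k] by (auto simp: r_def)
    qed
  qed
  moreover have "\<forall>i j. i < j \<longrightarrow> m' i j = 0" using m(1) by (simp add: m'_def)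
  moreover have "\<forall>i<Suc p. m' i i > 0"
    using m(2) r by (auto simp: m'_def less_Suc_eq r_def)
  ultimately show ?case by (intro exI[of _ m']) blast
qed

definition affine_map :: "nat \<Rightarrow> (nat \<Rightarrow> nat \<Rightarrow> real) \<Rightarrow> (nat \<Rightarrow> real) \<Rightarrow> (nat \<Rightarrow> real) \<Rightarrow> nat \<Rightarrow> real" where
  "affine_map p m \<mu> x = (\<lambda>i\<in>{..<p}. \<Sum>j<p. m i j * (x j - \<mu> j))"

lemma measurable_affine_map[measurable]:
  "affine_map p m \<mu> \<in> PiM {..<p} (\<lambda>_. borel) \<rightarrow>\<^sub>M PiM {..<p} (\<lambda>_. borel)"
  unfolding affine_map_def by measurable

text \<open>
  For a triangular map the change of variables needs only one-dimensional substitutions, one for each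
  coordinate, and Fubini.
\<close>

lemma nn_integral_triangular_map:
  assumes tri: "\<And>i j. i < j \<Longrightarrow> m i j = 0" and pos: "\<And>i. i < p \<Longrightarrow> m i i > 0"
    and f: "f \<in> borel_measurable (PiM {..<p} (\<lambda>_. borel))"
  shows "ennreal (\<Prod>i<p. m i i) * (\<integral>\<^sup>+x. f (affine_map p m \<mu> x) \<partial>PiM {..<p} (\<lambda>_. lborel))
       = (\<integral>\<^sup>+x. f x \<partial>PiM {..<p} (\<lambda>_. lborel))"
  using pos f
proof (induction p arbitrary: f)
  case 0
  have "(\<lambda>_. undefined) = affine_map 0 m \<mu> (\<lambda>_. undefined)" by (simp add: affine_map_def fun_eq_iff)
  then show ?case by (simp add: PiM_empty nn_integral_count_space_finite)
next
  case (Suc p)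
  interpret L: product_sigma_finite "\<lambda>_. lborel :: real measure" by unfold_locales
  have S: "{..<Suc p} = insert p {..<p}" by auto
  have f[measurable]: "f \<in> borel_measurable (PiM (insert p {..<p}) (\<lambda>_. borel))"
    using Suc.prems(2) unfolding S .
  have fu[measurable]: "(\<lambda>(x, y). f (x(p := y))) \<in> borel_measurable (PiM {..<p} (\<lambda>_. borel) \<Otimes>\<^sub>M borel)"
    using measurable_compose[OF measurable_add_dim f] by (simp add: case_prod_unfold)
  have step: "affine_map (Suc p) m \<mu> (x(p := y)) =
      (affine_map p m \<mu> x)(p := ((\<Sum>j<p. m p j * (x j - \<mu> j)) - m p p * \<mu> p) + m p p * y)" for x y
    using tri by (auto simp: affine_map_def fun_eq_iff restrict_def less_Suc_eq right_diff_distrib)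
  define g where "g z = (\<integral>\<^sup>+y. f (z(p := y)) \<partial>lborel)" for z
  have g: "g \<in> borel_measurable (PiM {..<p} (\<lambda>_. borel))"
    unfolding g_def by measurable
  have mp: "m p p > 0" using Suc.prems(1) by simp
  have inner: "ennreal (m p p) * (\<integral>\<^sup>+y. f (affine_map (Suc p) m \<mu> (x(p := y))) \<partial>lborel) = g (affine_map p m \<mu> x)"
    if x: "x \<in> space (PiM {..<p} (\<lambda>_. lborel))" for x
  proof -
    have z: "affine_map p m \<mu> x \<in> space (PiM {..<p} (\<lambda>_. borel))"
      by (simp add: affine_map_def space_PiM)
    have "(\<lambda>y. f ((affine_map p m \<mu> x)(p := y))) \<in> borel_measurable borel"
      using measurable_Pair_compose_split[OF fu measurable_const[OF z] measurable_ident] by simp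
    from nn_integral_real_affine[OF this, of "m p p" "(\<Sum>j<p. m p j * (x j - \<mu> j)) - m p p * \<mu> p"] mp
    show ?thesis unfolding step g_def by simp
  qed
  have mT: "(\<lambda>x. f (affine_map (Suc p) m \<mu> x)) \<in> borel_measurable (PiM (insert p {..<p}) (\<lambda>_. lborel))"
    using measurable_compose[OF measurable_affine_map[of "Suc p" m \<mu>] Suc.prems(2)] unfolding S
    by (simp cong: measurable_cong_sets sets_PiM_cong)
  have "ennreal (\<Prod>i<Suc p. m i i) * (\<integral>\<^sup>+x. f (affine_map (Suc p) m \<mu> x) \<partial>PiM {..<Suc p} (\<lambda>_. lborel))
     = ennreal (\<Prod>i<p. m i i) * (ennreal (m p p) *
        (\<integral>\<^sup>+x. \<integral>\<^sup>+y. f (affine_map (Suc p) m \<mu> (x(p := y))) \<partial>lborel \<partial>PiM {..<p} (\<lambda>_. lborel)))"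
  proof -
    have "(\<Prod>i<p. m i i) \<ge> 0" using Suc.prems(1) by (intro prod_nonneg) (auto simp: less_imp_le)
    then show ?thesis unfolding S using mp mT
      by (subst L.product_nn_integral_insert) (auto simp: ennreal_mult mult_ac S[symmetric])
  qed
  also have "\<dots> = ennreal (\<Prod>i<p. m i i) * (\<integral>\<^sup>+x. g (affine_map p m \<mu> x) \<partial>PiM {..<p} (\<lambda>_. lborel))"
  proof (subst nn_integral_cmult[symmetric])
    show "(\<lambda>x. \<integral>\<^sup>+ y. f (affine_map (Suc p) m \<mu> (x(p := y))) \<partial>lborel) \<in> borel_measurable (PiM {..<p} (\<lambda>_. lborel))"
    proof (rule lborel.borel_measurable_nn_integral)
      show "(\<lambda>(x, y). f (affine_map (Suc p) m \<mu> (x(p := y)))) \<in> borel_measurable (PiM {..<p} (\<lambda>_. lborel) \<Otimes>\<^sub>M lborel)"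
        using measurable_compose[OF measurable_add_dim mT] by (simp add: case_prod_unfold)
    qed
  qed (auto intro!: arg_cong2[where f = "(*)"] nn_integral_cong inner)
  also have "\<dots> = (\<integral>\<^sup>+x. g x \<partial>PiM {..<p} (\<lambda>_. lborel))"
    using Suc.prems(1) g by (intro Suc.IH) auto
  also have "\<dots> = (\<integral>\<^sup>+x. f x \<partial>PiM {..<Suc p} (\<lambda>_. lborel))"
    unfolding g_def S using f
    by (subst L.product_nn_integral_insert) (auto cong: measurable_cong_sets sets_PiM_cong)
  finally show ?case .
qed

text \<open>
  For a Cholesky factor \<open>m\<close> of the inverse covariance matrix, the quadratic form in the normal density is
  the squared length of \<open>m * (x - \<mu>)\<close>, and the product of the diagonal entries of \<open>m\<close> is
  \<open>1 / sqrt (det \<Sigma>)\<close>.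
\<close>

lemma positive_definite_whitening:
  assumes pd: "positive_definite p \<Sigma>" and \<mu>: "\<mu> \<in> carrier_vec p"
  obtains m where "\<And>i j. i < j \<Longrightarrow> m i j = 0" "\<And>i. i < p \<Longrightarrow> m i i > 0"
    "\<And>x. mvnormal_density p \<mu> \<Sigma> x = (\<Prod>i<p. m i i) *
       (\<Prod>i<p. std_normal_density (affine_map p m (\<lambda>i. \<mu> $ i) x i))"
    "Determinant.det \<Sigma> > 0" "(\<Prod>i<p. m i i)\<^sup>2 * Determinant.det \<Sigma> = 1"
proof -
  have S: "\<Sigma> \<in> carrier_mat p p" "transpose_mat \<Sigma> = \<Sigma>"
    and Spos: "\<And>v. v \<in> carrier_vec p \<Longrightarrow> v \<noteq> 0\<^sub>v p \<Longrightarrow> 0 < v \<bullet> (\<Sigma> *\<^sub>v v)"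
    using pd by (auto simp: positive_definite_def)
  have "Determinant.det \<Sigma> \<noteq> 0"
  proof
    assume "Determinant.det \<Sigma> = 0"
    then obtain v where "v \<in> carrier_vec p" "v \<noteq> 0\<^sub>v p" "\<Sigma> *\<^sub>v v = 0\<^sub>v p"
      using det_0_iff_vec_prod_zero[OF S(1)] by auto
    then show False using Spos[of v] by simp
  qed
  then have "\<Sigma> \<in> Units (ring_mat TYPE(real) p ())" using det_non_zero_imp_unit[OF S(1)] by simp
  then obtain B where inv: "mat_inverse \<Sigma> = Some B" using mat_inverse(1)[OF S(1)] by fastforce
  then have B: "\<Sigma> * B = 1\<^sub>m p" "B * \<Sigma> = 1\<^sub>m p" "B \<in> carrier_mat p p"
    using mat_inverse(2)[OF S(1)] by auto
  have Bt: "transpose_mat B = B"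
  proof -
    have "transpose_mat B * \<Sigma> = 1\<^sub>m p"
      using arg_cong[OF B(1), of transpose_mat] S B(3) by (simp add: transpose_mult[of \<Sigma> p p B p])
    then have "transpose_mat B * (\<Sigma> * B) = B"
      using S B(3) by (subst assoc_mult_mat[symmetric, of _ p p _ p _ p]) auto
    then show ?thesis using B by simp
  qed
  define Q where "Q j k = B $$ (j, k)" for j k
  have quad: "y \<bullet> (B *\<^sub>v y) = (\<Sum>j<p. \<Sum>k<p. Q j k * y $ j * y $ k)" if "y \<in> carrier_vec p" for y
  proof -
    have "y \<bullet> (B *\<^sub>v y) = (\<Sum>j<p. y $ j * (\<Sum>k<p. Q j k * y $ k))"
      using that B(3) by (auto simp: scalar_prod_def Q_def lessThan_atLeast0 intro!: sum.cong)
    then show ?thesis by (simp add: sum_distrib_left mult_ac)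
  qed
  have "(\<Sum>j<p. \<Sum>k<p. Q j k * v j * v k) > 0" if "\<exists>i<p. v i \<noteq> 0" for v
  proof -
    define y where "y = Matrix.vec p v"
    have y: "y \<in> carrier_vec p" "y \<noteq> 0\<^sub>v p" using that by (auto simp: y_def vec_eq_iff)
    define w where "w = B *\<^sub>v y"
    have w: "w \<in> carrier_vec p" using B(3) y by (auto simp: w_def)
    have Sw: "\<Sigma> *\<^sub>v w = y" unfolding w_def using S B y by (simp flip: assoc_mult_mat_vec)
    then have "w \<noteq> 0\<^sub>v p" using y S by auto
    then have "0 < w \<bullet> y" using Spos[OF w] Sw by simp
    also have "w \<bullet> y = y \<bullet> w" using comm_scalar_prod[OF w y(1)] .
    also have "\<dots> = (\<Sum>j<p. \<Sum>k<p. Q j k * v j * v k)" unfolding w_def quad[OF y(1)] by (simp add: y_def)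
    finally show ?thesis .
  qed
  moreover have "Q j k = Q k j" if "j < p" "k < p" for j k
    using that B(3) Bt index_transpose_mat(1)[of j B k] by (auto simp: Q_def)
  ultimately obtain m where m: "\<forall>i j. i < j \<longrightarrow> m i j = 0" "\<forall>i<p. m i i > 0"
    "\<forall>j<p. \<forall>k<p. Q j k = (\<Sum>i<p. m i j * m i k)" using cholesky[of p Q] by blast
  define L where "L = Matrix.mat p p (\<lambda>(i, j). m i j)"
  have L: "L \<in> carrier_mat p p" by (simp add: L_def)
  have "B = transpose_mat L * L"
    using B(3) m(3) by (intro eq_matI) (auto simp: L_def Q_def scalar_prod_def lessThan_atLeast0)
  then have "Determinant.det B = (Determinant.det L)\<^sup>2"
    using L by (simp add: det_mult[of _ p] det_transpose[of _ p] power2_eq_square)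
  also have "Determinant.det L = (\<Prod>i<p. m i i)"
    using det_lower_triangular[of p L] m(1) by (simp add: L_def prod_list_diag_prod lessThan_atLeast0)
  finally have "(\<Prod>i<p. m i i)\<^sup>2 * Determinant.det \<Sigma> = 1"
    using arg_cong[OF B(2), of Determinant.det] det_mult[OF B(3) S(1)] by simp
  moreover have P: "(\<Prod>i<p. m i i) > 0" using m(2) by (intro prod_pos) auto
  ultimately have det: "Determinant.det \<Sigma> > 0" "(\<Prod>i<p. m i i)\<^sup>2 * Determinant.det \<Sigma> = 1"
    by (auto simp: zero_less_mult_iff dest!: arg_cong[of _ _ "\<lambda>x. 0 < (x::real)"])
  have sq: "sqrt (Determinant.det \<Sigma>) = 1 / (\<Prod>i<p. m i i)"
  proof (rule real_sqrt_unique)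
    have "Determinant.det \<Sigma> = 1 / (\<Prod>i<p. m i i)\<^sup>2"
      by (rule eq_divide_imp[OF less_imp_neq[OF zero_less_power[OF P], symmetric]])
        (use det(2) in \<open>simp only: mult.commute\<close>)
    then show "(1 / (\<Prod>i<p. m i i))\<^sup>2 = Determinant.det \<Sigma>" by (simp add: power_divide)
  qed (use P in simp)
  have "mvnormal_density p \<mu> \<Sigma> x = (\<Prod>i<p. m i i) *
       (\<Prod>i<p. std_normal_density (affine_map p m (\<lambda>i. \<mu> $ i) x i))" for x
  proof -
    define y where "y = Matrix.vec p x - \<mu>"
    have y: "y \<in> carrier_vec p" using \<mu> by (simp add: y_def)
    have yi: "y $ i = x i - \<mu> $ i" if "i < p" for i using that \<mu> by (simp add: y_def)
    have "y \<bullet> (B *\<^sub>v y) = (\<Sum>j<p. \<Sum>k<p. (\<Sum>i<p. m i j * m i k) * y $ j * y $ k)"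
      unfolding quad[OF y] using m(3) by (intro sum.cong) auto
    also have "\<dots> = (\<Sum>j<p. \<Sum>k<p. \<Sum>i<p. (m i j * y $ j) * (m i k * y $ k))"
      by (simp add: sum_distrib_right sum_distrib_left mult_ac)
    also have "\<dots> = (\<Sum>j<p. \<Sum>i<p. \<Sum>k<p. (m i j * y $ j) * (m i k * y $ k))"
      by (intro sum.cong refl sum.swap)
    also have "\<dots> = (\<Sum>i<p. \<Sum>j<p. \<Sum>k<p. (m i j * y $ j) * (m i k * y $ k))"
      by (rule sum.swap)
    also have "\<dots> = (\<Sum>i<p. (\<Sum>j<p. m i j * y $ j)\<^sup>2)"
      by (simp add: power2_eq_square sum_product)
    also have "\<dots> = (\<Sum>i<p. (affine_map p m (\<lambda>i. \<mu> $ i) x i)\<^sup>2)"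
      by (intro sum.cong) (auto simp: affine_map_def yi)
    finally have "y \<bullet> (B *\<^sub>v y) = (\<Sum>i<p. (affine_map p m (\<lambda>i. \<mu> $ i) x i)\<^sup>2)" .
    then show ?thesis
      unfolding mvnormal_density_def prod_std_normal_density Let_def y_def[symmetric] inv option.sel
      using P by (simp add: real_sqrt_mult sq)
  qed
  from that[OF m(1)[rule_format] m(2)[rule_format] this det] show ?thesis .
qed

lemma distr_whitened:
  assumes X: "mvnormal_distributed M p \<mu> \<Sigma> X"
    and tri: "\<And>i j. i < j \<Longrightarrow> m i j = 0" and pos: "\<And>i. i < p \<Longrightarrow> m i i > 0"
    and dens: "\<And>x. mvnormal_density p \<mu> \<Sigma> x = (\<Prod>i<p. m i i) *
       (\<Prod>i<p. std_normal_density (affine_map p m \<nu> x i))"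
  shows "distr M (PiM {..<p} (\<lambda>_. borel)) (\<lambda>\<omega>. affine_map p m \<nu> (X \<omega>)) = gauss {..<p}"
proof (rule measure_eqI)
  let ?B = "PiM {..<p} (\<lambda>_. borel :: real measure)" and ?L = "PiM {..<p} (\<lambda>_. lborel :: real measure)"
  have BL: "sets ?L = sets ?B" by (intro sets_PiM_cong) auto
  have d: "distr M ?L X = density ?L (\<lambda>x. ennreal (mvnormal_density p \<mu> \<Sigma> x))"
    and dm: "(\<lambda>x. ennreal (mvnormal_density p \<mu> \<Sigma> x)) \<in> borel_measurable ?L"
    and Xm: "X \<in> M \<rightarrow>\<^sub>M ?L"
    using X by (auto simp: mvnormal_distributed_def distributed_def)
  have Xm'[measurable]: "X \<in> M \<rightarrow>\<^sub>M ?B" using Xm BL by (simp cong: measurable_cong_sets)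
  fix A assume "A \<in> sets (distr M ?B (\<lambda>\<omega>. affine_map p m \<nu> (X \<omega>)))"
  then have A[measurable]: "A \<in> sets ?B" by simp
  have aL: "affine_map p m \<nu> \<in> ?L \<rightarrow>\<^sub>M ?B"
    using measurable_affine_map[of p m \<nu>] BL by (simp cong: measurable_cong_sets)
  have "emeasure (distr M ?B (\<lambda>\<omega>. affine_map p m \<nu> (X \<omega>))) A = (\<integral>\<^sup>+\<omega>. indicator A (affine_map p m \<nu> (X \<omega>)) \<partial>M)"
    by (subst nn_integral_indicator[symmetric], simp, subst nn_integral_distr) simp_all
  also have "\<dots> = (\<integral>\<^sup>+x. indicator A (affine_map p m \<nu> x) \<partial>distr M ?L X)"
    by (rule nn_integral_distr[OF Xm, symmetric])
      (unfold measurable_distr_eq1, rule measurable_compose[OF aL], simp)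
  also have "\<dots> = (\<integral>\<^sup>+x. ennreal (mvnormal_density p \<mu> \<Sigma> x) * indicator A (affine_map p m \<nu> x) \<partial>?L)"
    unfolding d by (rule nn_integral_density[OF dm]) (rule measurable_compose[OF aL], simp)
  also have "\<dots> = (\<integral>\<^sup>+x. ennreal (\<Prod>i<p. m i i) * (ennreal (\<Prod>i<p. std_normal_density (affine_map p m \<nu> x i))
      * indicator A (affine_map p m \<nu> x)) \<partial>?L)"
  proof -
    have "0 \<le> (\<Prod>i<p. m i i)" using pos by (intro prod_nonneg) (simp add: less_imp_le)
    then show ?thesis unfolding dens by (simp add: ennreal_mult' mult.assoc)
  qed
  also have "\<dots> = ennreal (\<Prod>i<p. m i i) * (\<integral>\<^sup>+x. ennreal (\<Prod>i<p. std_normal_density (affine_map p m \<nu> x i))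
      * indicator A (affine_map p m \<nu> x) \<partial>?L)"
    by (rule nn_integral_cmult) (rule measurable_compose[OF aL, where g = "\<lambda>z. ennreal (\<Prod>i<p. std_normal_density (z i)) * indicator A z"], measurable)
  also have "\<dots> = (\<integral>\<^sup>+x. ennreal (\<Prod>i<p. std_normal_density (x i)) * indicator A x \<partial>?L)"
    using tri pos by (intro nn_integral_triangular_map[where f = "\<lambda>z. ennreal (\<Prod>i<p. std_normal_density (z i)) * indicator A z"]) auto
  also have "\<dots> = emeasure (gauss {..<p}) A"
    unfolding gauss_eq_density[OF finite_lessThan] using BL by (subst emeasure_density) auto
  finally show "emeasure (distr M ?B (\<lambda>\<omega>. affine_map p m \<nu> (X \<omega>))) A = emeasure (gauss {..<p}) A" .
qed (simp add: sets_gauss)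

section \<open>The determinant of the sample covariance matrix\<close>

lemma measurable_flatten:
  "(\<lambda>y. \<lambda>(k, i)\<in>K \<times> C. y k i) \<in> PiM K (\<lambda>_. PiM C (\<lambda>_. N)) \<rightarrow>\<^sub>M PiM (K \<times> C) (\<lambda>_. N)"
proof (rule measurable_restrict)
  fix p assume "p \<in> K \<times> C"
  then have "fst p \<in> K" "snd p \<in> C" by auto
  then have "(\<lambda>y. y (fst p)) \<in> PiM K (\<lambda>_. PiM C (\<lambda>_. N)) \<rightarrow>\<^sub>M PiM C (\<lambda>_. N)"
    and "(\<lambda>z. z (snd p)) \<in> PiM C (\<lambda>_. N) \<rightarrow>\<^sub>M N"
    by (auto intro: measurable_component_singleton)
  from measurable_compose[OF this]
  have "(\<lambda>y. y (fst p) (snd p)) \<in> PiM K (\<lambda>_. PiM C (\<lambda>_. N)) \<rightarrow>\<^sub>M N" .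
  then show "(\<lambda>y. case p of (k, i) \<Rightarrow> y k i) \<in> PiM K (\<lambda>_. PiM C (\<lambda>_. N)) \<rightarrow>\<^sub>M N"
    by (simp add: case_prod_unfold)
qed

lemma gauss_flatten:
  fixes K :: "'k set" and C :: "'c set"
  assumes K: "finite K" and C: "finite C"
  shows "distr (PiM K (\<lambda>_. gauss C)) (gauss (K \<times> C)) (\<lambda>y. \<lambda>(k, i)\<in>K \<times> C. y k i) = gauss (K \<times> C)"
    (is "distr ?M _ ?f = _")
proof -
  interpret C: product_sigma_finite "\<lambda>_ :: 'k. gauss C"
    by (intro product_sigma_finite.intro prob_space_imp_sigma_finite prob_space_gauss)
  have f: "?f \<in> ?M \<rightarrow>\<^sub>M gauss (K \<times> C)"
    unfolding gauss_def by (rule measurable_flatten)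
  show ?thesis
    unfolding gauss_def[of "K \<times> C"]
  proof (rule gauss_prod.PiM_eqI)
    show "finite (K \<times> C)" using assms by simp
    fix A :: "'k \<times> 'c \<Rightarrow> real set"
    assume A: "\<And>p. p \<in> K \<times> C \<Longrightarrow> A p \<in> sets std_normal_distribution"
    then have A': "A (k, i) \<in> sets std_normal_distribution" if "k \<in> K" "i \<in> C" for k i using that by auto
    have "?f -` (PiE (K \<times> C) A) \<inter> space ?M = PiE K (\<lambda>k. PiE C (\<lambda>i. A (k, i)))"
    proof (intro equalityI subsetI)
      fix y assume y: "y \<in> ?f -` (PiE (K \<times> C) A) \<inter> space ?M"
      then have "y k i \<in> A (k, i)" if "k \<in> K" "i \<in> C" for k i
        using PiE_mem[of "?f y" "K \<times> C" A "(k, i)"] that by simp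
      moreover have "y \<in> extensional K" "\<And>k. k \<in> K \<Longrightarrow> y k \<in> extensional C"
        using y by (simp_all add: space_PiM space_gauss PiE_iff)
      ultimately show "y \<in> PiE K (\<lambda>k. PiE C (\<lambda>i. A (k, i)))" by (simp add: PiE_iff)
    next
      fix y assume "y \<in> PiE K (\<lambda>k. PiE C (\<lambda>i. A (k, i)))"
      then show "y \<in> ?f -` (PiE (K \<times> C) A) \<inter> space ?M"
        by (simp add: space_PiM space_gauss PiE_iff)
    qed
    then have "emeasure (distr ?M (gauss (K \<times> C)) ?f) (PiE (K \<times> C) A)
        = emeasure ?M (PiE K (\<lambda>k. PiE C (\<lambda>i. A (k, i))))"
      using A assms f by (subst emeasure_distr) (auto simp: sets_gauss intro!: sets_PiM_I_finite)
    also have "\<dots> = (\<Prod>k\<in>K. emeasure (gauss C) (PiE C (\<lambda>i. A (k, i))))"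
      using K C A' by (subst C.emeasure_PiM) (auto simp: sets_gauss intro!: sets_PiM_I_finite)
    also have "\<dots> = (\<Prod>k\<in>K. \<Prod>i\<in>C. emeasure std_normal_distribution (A (k, i)))"
      unfolding gauss_def using C A' by (intro prod.cong refl gauss_prod.emeasure_PiM) auto
    also have "\<dots> = (\<Prod>p\<in>K \<times> C. emeasure std_normal_distribution (A p))"
      by (simp add: prod.cartesian_product)
    finally show "emeasure (distr ?M (PiM (K \<times> C) (\<lambda>_. std_normal_distribution)) ?f) (PiE (K \<times> C) A)
      = (\<Prod>p\<in>K \<times> C. emeasure std_normal_distribution (A p))" unfolding gauss_def[of "K \<times> C"] .
  qed simp
qed

text \<open>
  By independence the joint law of the whitened observations is a product over observations of products
  over coordinates, which flattens into a single product over matrix entries.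
\<close>

lemma (in prob_space) distr_whitened_sample:
  assumes ind: "indep_vars (\<lambda>_. PiM {..<p} (\<lambda>_. borel)) X K" and K: "finite K" "K \<noteq> {}"
    and d: "\<And>k. k \<in> K \<Longrightarrow> distr M (PiM {..<p} (\<lambda>_. borel)) (\<lambda>\<omega>. affine_map p m \<nu> (X k \<omega>)) = gauss {..<p}"
  defines "G \<equiv> \<lambda>\<omega>. \<lambda>(k, i)\<in>K \<times> {..<p}. affine_map p m \<nu> (X k \<omega>) i"
  shows "G \<in> M \<rightarrow>\<^sub>M gauss (K \<times> {..<p})" "distr M (gauss (K \<times> {..<p})) G = gauss (K \<times> {..<p})"
proof -
  let ?B = "PiM {..<p} (\<lambda>_. borel :: real measure)"
  let ?Y = "\<lambda>k \<omega>. affine_map p m \<nu> (X k \<omega>)"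
  have indY: "indep_vars (\<lambda>_. ?B) ?Y K"
    by (rule indep_vars_compose2[OF ind]) simp
  have Y: "?Y k \<in> M \<rightarrow>\<^sub>M ?B" if "k \<in> K" for k using indY that by (auto simp: indep_vars_def)
  have "distr M (PiM K (\<lambda>_. ?B)) (\<lambda>\<omega>. \<lambda>k\<in>K. ?Y k \<omega>) = PiM K (\<lambda>k. distr M ?B (?Y k))"
    using indep_vars_iff_distr_eq_PiM'[where M' = "\<lambda>_. ?B" and X = ?Y, OF K(2)] Y indY by blast
  also have "\<dots> = PiM K (\<lambda>_. gauss {..<p})" by (intro PiM_cong d) auto
  finally have D: "distr M (PiM K (\<lambda>_. ?B)) (\<lambda>\<omega>. \<lambda>k\<in>K. ?Y k \<omega>) = PiM K (\<lambda>_. gauss {..<p})" .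
  let ?f = "\<lambda>y :: _ \<Rightarrow> nat \<Rightarrow> real. \<lambda>(k, i)\<in>K \<times> {..<p}. y k i"
  have f: "?f \<in> PiM K (\<lambda>_. ?B) \<rightarrow>\<^sub>M gauss (K \<times> {..<p})"
    using measurable_flatten[of K "{..<p}" borel] by (simp cong: measurable_cong_sets add: sets_gauss)
  have Ym: "(\<lambda>\<omega>. \<lambda>k\<in>K. ?Y k \<omega>) \<in> M \<rightarrow>\<^sub>M PiM K (\<lambda>_. ?B)"
    using Y by (intro measurable_restrict) auto
  have G: "G = ?f \<circ> (\<lambda>\<omega>. \<lambda>k\<in>K. ?Y k \<omega>)"
    by (auto simp: G_def fun_eq_iff restrict_def)
  show "G \<in> M \<rightarrow>\<^sub>M gauss (K \<times> {..<p})" unfolding G using Ym f by (rule measurable_comp)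
  have "distr M (gauss (K \<times> {..<p})) G = distr (PiM K (\<lambda>_. gauss {..<p})) (gauss (K \<times> {..<p})) ?f"
    unfolding G using distr_distr[OF f Ym] unfolding D by simp
  also have "\<dots> = gauss (K \<times> {..<p})" by (rule gauss_flatten) (use K in auto)
  finally show "distr M (gauss (K \<times> {..<p})) G = gauss (K \<times> {..<p})" .
qed

lemma det_triangular_transposed:
  fixes m :: "nat \<Rightarrow> nat \<Rightarrow> real"
  assumes "\<And>i j. i < j \<Longrightarrow> m i j = 0"
  shows "Determinant.det (Matrix.mat n n (\<lambda>(j, i). m i j)) = (\<Prod>i<n. m i i)"
  using assms
  by (subst det_upper_triangular[of _ n]) (auto simp: upper_triangular_def prod_list_diag_prod lessThan_atLeast0)

text \<open>
  With a first column of ones, an affine map applied to all observations is a multiplication of the bordered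
  matrix by a block triangular matrix from the right. This covers both centring, where the factor has
  determinant \<open>1\<close>, and whitening.
\<close>

lemma det_bordered_affine:
  "Determinant.det (bordered n r 0 (\<lambda>_. 1) (\<lambda>(k, i). (\<Sum>j<n. m i j * g (k, j)) - c i))
   = Determinant.det (bordered n r 0 (\<lambda>_. 1) g) * Determinant.det (Matrix.mat n n (\<lambda>(j, i). m i j))"
    (is "Determinant.det ?L = Determinant.det ?A * Determinant.det ?T")
proof -
  let ?a = "Matrix.mat 1 1 (\<lambda>_. 1 :: real)" and ?b = "Matrix.mat 1 n (\<lambda>(_, i). - c i)"
  let ?W = "four_block_mat ?a ?b (0\<^sub>m n 1) ?T"
  have W: "?W \<in> carrier_mat (Suc n) (Suc n)" using four_block_carrier_mat[of ?a 1 1 ?T n n] by simp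
  have "?L = ?A * ?W"
  proof (rule eq_matI)
    fix i j assume "i < dim_row (?A * ?W)" "j < dim_col (?A * ?W)"
    then have ij: "i < Suc n" "j < Suc n" using W by (auto simp: bordered_def)
    have "(?A * ?W) $$ (i, j) = (\<Sum>l=0..<Suc n. ?A $$ (i, l) * ?W $$ (l, j))"
      using ij W by (auto simp: scalar_prod_def bordered_def intro!: sum.cong)
    also have "\<dots> = ?W $$ (0, j) + (\<Sum>l<n. g (r + i, l) * ?W $$ (Suc l, j))"
      unfolding sum.atLeast0_lessThan_Suc_shift using ij
      by (auto simp: bordered_def lessThan_atLeast0 intro!: sum.cong)
    also have "\<dots> = ?L $$ (i, j)"
      using ij by (cases j) (auto simp: bordered_def mult.commute intro!: sum.cong)
    finally show "?L $$ (i, j) = (?A * ?W) $$ (i, j)" by simp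
  qed (use W in \<open>auto simp: bordered_def\<close>)
  moreover have "Determinant.det ?W = Determinant.det ?T"
    by (subst det_four_block_mat_lower_left_zero_col[of _ _ n]) (auto simp: det_single)
  ultimately show ?thesis using det_mult[OF _ W, of ?A] by simp
qed

text \<open>
  Centring makes the Gram matrix of the bordered matrix block diagonal, with blocks \<open>n + 1\<close> and \<open>n\<close> times
  the sample covariance matrix.
\<close>

lemma det_sample_covariance:
  fixes x :: "nat \<Rightarrow> nat \<Rightarrow> real"
  assumes n: "n \<ge> 1"
  shows "Determinant.det (sample_covariance n n (\<lambda>k. Matrix.vec n (x k))) * (real (n + 1) * real n ^ n)
       = (Determinant.det (bordered n 1 0 (\<lambda>_. 1) (\<lambda>(k, i). x k i)))\<^sup>2"
proof -
  define c where "c i = (\<Sum>k=1..n+1. x k i) / real (n + 1)" for i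
  define S where "S = sample_covariance n n (\<lambda>k. Matrix.vec n (x k))"
  have S: "S \<in> carrier_mat n n" by (simp add: S_def sample_covariance_def)
  \<comment> \<open>Centring at the sample mean is the affine map with the identity as linear part.\<close>
  let ?id = "\<lambda>i j :: nat. if i = j then 1 else 0 :: real"
  have "(\<Sum>j<n. ?id i j * x k j) - c i = x k i - c i" if "i < n" for i k
    using that by (simp add: if_distrib[of "\<lambda>x. x * _"] cong: if_cong)
  then have "bordered n 1 0 (\<lambda>_. 1) (\<lambda>(k, i). (\<Sum>j<n. ?id i j * (case (k, j) of (k, i) \<Rightarrow> x k i)) - c i)
      = bordered n 1 0 (\<lambda>_. 1) (\<lambda>(k, i). x k i - c i)"
    by (intro bordered_cong) auto
  moreover have "Determinant.det (Matrix.mat n n (\<lambda>(j, i). ?id i j)) = 1"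
    by (subst det_triangular_transposed) auto
  ultimately have "Determinant.det (bordered n 1 0 (\<lambda>_. 1) (\<lambda>(k, i). x k i))
      = Determinant.det (bordered n 1 0 (\<lambda>_. 1) (\<lambda>(k, i). x k i - c i))"
    using det_bordered_affine[of n 1 ?id "\<lambda>(k, i). x k i" c] by simp
  also have "(Determinant.det (bordered n 1 0 (\<lambda>_. 1) (\<lambda>(k, i). x k i - c i)))\<^sup>2
     = Determinant.det (four_block_mat (Matrix.mat 1 1 (\<lambda>_. real (n + 1))) (0\<^sub>m 1 n) (0\<^sub>m n 1) (real n \<cdot>\<^sub>m S))"
    unfolding det_bordered_power2
  proof (intro arg_cong[where f = Determinant.det] eq_matI)
    have c0: "(\<Sum>k=1..1+n. x k i - c i) = 0" for i
      by (simp add: sum_subtractf c_def)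
    fix j k assume "j < dim_row (four_block_mat (Matrix.mat 1 1 (\<lambda>_. real (n + 1))) (0\<^sub>m 1 n) (0\<^sub>m n 1) (real n \<cdot>\<^sub>m S))"
      "k < dim_col (four_block_mat (Matrix.mat 1 1 (\<lambda>_. real (n + 1))) (0\<^sub>m 1 n) (0\<^sub>m n 1) (real n \<cdot>\<^sub>m S))"
    then have jk: "j < Suc n" "k < Suc n" using S by auto
    have mean: "sample_mean n n (\<lambda>k. Matrix.vec n (x k)) $ i = c i" if "i < n" for i
      using that by (simp add: sample_mean_def c_def)
    have Sjk: "real n * S $$ (a, b) = (\<Sum>l=1..1+n. (x l a - c a) * (x l b - c b))" if "a < n" "b < n" for a b
      using that n mean by (simp add: S_def sample_covariance_def) (simp add: sample_mean_def)
    show "Matrix.mat (Suc n) (Suc n) (\<lambda>(j, k). \<Sum>i\<in>{1..1+n}.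
        (case j of 0 \<Rightarrow> 1 | Suc j \<Rightarrow> case (i, 0 + j) of (k, i) \<Rightarrow> x k i - c i) *
        (case k of 0 \<Rightarrow> 1 | Suc k \<Rightarrow> case (i, 0 + k) of (k, i) \<Rightarrow> x k i - c i)) $$ (j, k)
      = four_block_mat (Matrix.mat 1 1 (\<lambda>_. real (n + 1))) (0\<^sub>m 1 n) (0\<^sub>m n 1) (real n \<cdot>\<^sub>m S) $$ (j, k)"
    proof (cases j)
      case 0
      then show ?thesis using jk S c0 by (cases k) auto
    next
      case (Suc a)
      then show ?thesis using jk S c0 Sjk by (cases k) auto
    qed
  qed (use S in auto)
  also have "\<dots> = real (n + 1) * (real n ^ n * Determinant.det S)"
    using S by (subst det_four_block_mat_lower_left_zero_col[of _ _ n]) (auto simp: det_single)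
  finally show ?thesis by (simp add: S_def mult_ac)
qed

lemma imag_power_0: "imag_power 0 x = of_real (indicator {0<..} x)"
  by (simp add: imag_power_def)

lemma chi_square_mellin_0: "k \<ge> 1 \<Longrightarrow> chi_square_mellin k 0 = 1"
  by (simp add: chi_square_mellin_def ln_Gamma_complex_of_real[symmetric])

text \<open>
  \<open>D\<close> is the squared determinant of the whitened sample bordered by ones, divided by \<open>n + 1\<close>, the squared
  length of the column of ones. The formula for its Mellin transform holds for all \<open>s\<close>; at \<open>s = 0\<close> it says
  that \<open>D\<close> is almost surely positive.
\<close>

lemma sample_covariance_mellin:
  assumes M: "prob_space M" and n: "n \<ge> 1" and \<mu>: "\<mu> \<in> carrier_vec n"
    and pd: "positive_definite n \<Sigma>"
    and ind: "prob_space.indep_vars M (\<lambda>_. \<Pi>\<^sub>M i\<in>{..<n}. borel) X {1..n + 1}"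
    and mvn: "\<And>k. k \<in> {1..n + 1} \<Longrightarrow> mvnormal_distributed M n \<mu> \<Sigma> (X k)"
  obtains D where "D \<in> borel_measurable M"
    "\<And>\<omega>. Determinant.det (sample_covariance n n (\<lambda>k. Matrix.vec n (X k \<omega>))) = D \<omega> * Determinant.det \<Sigma> / (real n ^ n)"
    "\<And>s. (\<integral>\<omega>. imag_power s (D \<omega>) \<partial>M) = (\<Prod>k=1..n. chi_square_mellin k s)"
    "Determinant.det \<Sigma> > 0" "AE \<omega> in M. D \<omega> > 0"
proof -
  interpret prob_space M by fact
  obtain m where tri: "\<And>i j. i < j \<Longrightarrow> m i j = 0" and pos: "\<And>i. i < n \<Longrightarrow> m i i > 0"
    and dens: "\<And>x. mvnormal_density n \<mu> \<Sigma> x = (\<Prod>i<n. m i i) *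
       (\<Prod>i<n. std_normal_density (affine_map n m (\<lambda>i. \<mu> $ i) x i))"
    and det: "Determinant.det \<Sigma> > 0" "(\<Prod>i<n. m i i)\<^sup>2 * Determinant.det \<Sigma> = 1"
    by (rule positive_definite_whitening[OF pd \<mu>]) blast
  let ?T = "affine_map n m (\<lambda>i. \<mu> $ i)" and ?I = "{1..n+1} \<times> {..<n}"
  define G where "G \<omega> = (\<lambda>(k, i)\<in>?I. ?T (X k \<omega>) i)" for \<omega>
  have G: "G \<in> M \<rightarrow>\<^sub>M gauss ?I" "distr M (gauss ?I) G = gauss ?I"
    unfolding G_def using distr_whitened[OF mvn tri pos dens]
    by (intro distr_whitened_sample[OF ind]; simp)+
  have I: "{1..1+n} \<times> {0..<0+n} = ?I" by auto
  define E where "E g = (Determinant.det (bordered n 1 0 (\<lambda>_. 1) g))\<^sup>2" for g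
  have E: "E \<in> borel_measurable (gauss ?I)"
    unfolding E_def I[symmetric] by (intro borel_measurable_power measurable_det_bordered) auto
  define D where "D \<omega> = E (G \<omega>) / real (n + 1)" for \<omega>
  have D: "D \<in> borel_measurable M"
    unfolding D_def using measurable_compose[OF G(1) E] by simp
  have "Determinant.det (sample_covariance n n (\<lambda>k. Matrix.vec n (X k \<omega>))) = D \<omega> * Determinant.det \<Sigma> / (real n ^ n)" for \<omega>
  proof -
    have "bordered n 1 0 (\<lambda>_. 1) (G \<omega>) = bordered n 1 0 (\<lambda>_. 1)
        (\<lambda>(k, i). (\<Sum>j<n. m i j * (case (k, j) of (k, i) \<Rightarrow> X k \<omega> i)) - (\<Sum>j<n. m i j * \<mu> $ j))"
      by (intro bordered_cong) (auto simp: G_def affine_map_def right_diff_distrib sum_subtractf)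
    then have "Determinant.det (bordered n 1 0 (\<lambda>_. 1) (G \<omega>))
        = Determinant.det (bordered n 1 0 (\<lambda>_. 1) (\<lambda>(k, i). X k \<omega> i)) * (\<Prod>i<n. m i i)"
      using det_bordered_affine[of n 1 m "\<lambda>(k, i). X k \<omega> i" "\<lambda>i. \<Sum>j<n. m i j * \<mu> $ j"]
      by (simp only: det_triangular_transposed[OF tri])
    then have "E (G \<omega>) * Determinant.det \<Sigma> = (Determinant.det (bordered n 1 0 (\<lambda>_. 1) (\<lambda>(k, i). X k \<omega> i)))\<^sup>2
       * ((\<Prod>i<n. m i i)\<^sup>2 * Determinant.det \<Sigma>)"
      by (simp only: E_def power_mult_distrib mult.assoc)
    also have "\<dots> = Determinant.det (sample_covariance n n (\<lambda>k. Matrix.vec n (X k \<omega>))) * (real (n + 1) * real n ^ n)"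
      unfolding det det_sample_covariance[OF n] by simp
    finally have "E (G \<omega>) * Determinant.det \<Sigma>
       = Determinant.det (sample_covariance n n (\<lambda>k. Matrix.vec n (X k \<omega>))) * (real (n + 1) * real n ^ n)" .
    moreover have "D \<omega> * Determinant.det \<Sigma> / real n ^ n = E (G \<omega>) * Determinant.det \<Sigma> / (real (n + 1) * real n ^ n)"
      by (simp add: D_def)
    moreover have "real (n + 1) * real n ^ n \<noteq> 0" using n by simp
    ultimately show ?thesis by (metis nonzero_mult_div_cancel_right)
  qed
  moreover have mellin: "(\<integral>\<omega>. imag_power s (D \<omega>) \<partial>M) = (\<Prod>k=1..n. chi_square_mellin k s)" for s
  proof -
    have "imag_power s (D \<omega>) = imag_power s (1 / real (n + 1)) * imag_power s (E (G \<omega>))" for \<omega>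
      by (subst imag_power_mult[symmetric]) (auto simp: D_def E_def)
    then have "(\<integral>\<omega>. imag_power s (D \<omega>) \<partial>M) = imag_power s (1 / real (n + 1)) * (\<integral>\<omega>. imag_power s (E (G \<omega>)) \<partial>M)"
      by simp
    also have "(\<integral>\<omega>. imag_power s (E (G \<omega>)) \<partial>M) = (\<integral>g. imag_power s (E g) \<partial>gauss ?I)"
      using measurable_compose[OF E measurable_imag_power] by (subst G(2)[symmetric], subst integral_distr[OF G(1)]) auto
    also have "\<dots> = border_mellin s n 1 0 (\<lambda>_. 1)"
      unfolding border_mellin_def I E_def ..
    also have "\<dots> = imag_power s (real (n + 1)) * (\<Prod>k=1..n. chi_square_mellin k s)"
      unfolding border_mellin_eq by simp
    also have "imag_power s (1 / real (n + 1)) * \<dots> = imag_power s (1 / real (n + 1) * real (n + 1)) * (\<Prod>k=1..n. chi_square_mellin k s)"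
      by (subst imag_power_mult) auto
    finally show ?thesis by (simp add: imag_power_def)
  qed
  moreover have "AE \<omega> in M. D \<omega> > 0"
  proof -
    have "(\<integral>\<omega>. imag_power 0 (D \<omega>) \<partial>M) = 1"
      unfolding mellin by (intro prod.neutral) (auto simp: chi_square_mellin_0)
    then have "(\<integral>\<omega>. indicator {0<..} (D \<omega>) \<partial>M) = (1 :: real)"
      by (simp add: imag_power_0 del: of_real_indicator) 
    also have "(\<integral>\<omega>. indicator {0<..} (D \<omega>) \<partial>M) = (\<integral>\<omega>. indicator {\<omega> \<in> space M. D \<omega> > 0} \<omega> \<partial>M :: real)"
      by (intro Bochner_Integration.integral_cong) (auto simp: indicator_def)
    also have "\<dots> = prob {\<omega> \<in> space M. D \<omega> > 0}" using D by simp
    finally have "prob {\<omega> \<in> space M. D \<omega> > 0} = 1" .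
    from AE_prob_1[OF this] show ?thesis by (auto elim: eventually_mono)
  qed
  ultimately show ?thesis using that D det(1) by blast
qed

section \<open>The central limit theorem\<close>

theorem corollary3:
  fixes M :: "nat \<Rightarrow> 'a measure"
    and \<mu> :: "nat \<Rightarrow> real Matrix.vec"
    and \<Sigma> :: "nat \<Rightarrow> real mat"
    and X :: "nat \<Rightarrow> nat \<Rightarrow> 'a \<Rightarrow> nat \<Rightarrow> real"
  assumes "\<And>n. n \<ge> 1 \<Longrightarrow> prob_space (M n)"
    and "\<And>n. n \<ge> 1 \<Longrightarrow> \<mu> n \<in> carrier_vec n"
    and "\<And>n. n \<ge> 1 \<Longrightarrow> positive_definite n (\<Sigma> n)"
    and "\<And>n. n \<ge> 1 \<Longrightarrow>
           prob_space.indep_vars (M n) (\<lambda>_. \<Pi>\<^sub>M i\<in>{..<n}. borel) (X n) {1..n + 1}"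
    and "\<And>n k. n \<ge> 1 \<Longrightarrow> k \<in> {1..n + 1} \<Longrightarrow>
           mvnormal_distributed (M n) n (\<mu> n) (\<Sigma> n) (X n k)"
  shows "weak_conv_m
           (\<lambda>n. distr (M n) borel (\<lambda>\<omega>.
              (ln (Determinant.det (sample_covariance n n (\<lambda>k. Matrix.vec n (X n k \<omega>))))
                 - ln (fact (n - 1)) + real n * ln (real n) - ln (Determinant.det (\<Sigma> n)))
              / sqrt (2 * ln (real n))))
           std_normal_distribution"
proof -
  define Y where "Y n \<omega> = (ln (Determinant.det (sample_covariance n n (\<lambda>k. Matrix.vec n (X n k \<omega>))))
                 - ln (fact (n - 1)) + real n * ln (real n) - ln (Determinant.det (\<Sigma> n)))
              / sqrt (2 * ln (real n))" for n \<omega>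
  define s where "s t n = t / sqrt (2 * ln (real n))" for t and n :: nat
  have main: "Y n \<in> borel_measurable (M n)"
      "char (distr (M n) borel (Y n)) t = exp (- (\<i> * of_real (s t n * ln (fact (n - 1))))) * (\<Prod>k=1..n. chi_square_mellin k (s t n))"
    if n: "n \<ge> 1" for n t
  proof -
    interpret prob_space "M n" by (rule assms(1)[OF n])
    obtain D where D[measurable]: "D \<in> borel_measurable (M n)"
      and eq: "\<And>\<omega>. Determinant.det (sample_covariance n n (\<lambda>k. Matrix.vec n (X n k \<omega>))) = D \<omega> * Determinant.det (\<Sigma> n) / (real n ^ n)"
      and mellin: "\<And>s. (\<integral>\<omega>. imag_power s (D \<omega>) \<partial>M n) = (\<Prod>k=1..n. chi_square_mellin k s)"
      and det: "Determinant.det (\<Sigma> n) > 0" and D0: "AE \<omega> in M n. D \<omega> > 0"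
      using sample_covariance_mellin[OF assms(1)[OF n] n assms(2)[OF n] assms(3)[OF n] assms(4)[OF n] assms(5)[OF n]]
      by blast
    show Y: "Y n \<in> borel_measurable (M n)"
      unfolding Y_def eq by measurable
    have Y_eq: "Y n \<omega> = (ln (D \<omega>) - ln (fact (n - 1))) / sqrt (2 * ln (real n))" if "D \<omega> > 0" for \<omega>
      using that det n by (simp add: Y_def eq ln_mult_pos ln_div ln_realpow)
    have "char (distr (M n) borel (Y n)) t = (\<integral>\<omega>. iexp (t * Y n \<omega>) \<partial>M n)"
      unfolding char_def using Y by (subst integral_distr) auto
    also have "\<dots> = (\<integral>\<omega>. exp (- (\<i> * of_real (s t n * ln (fact (n - 1))))) * imag_power (s t n) (D \<omega>) \<partial>M n)"
    proof (rule integral_cong_AE)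
      show "AE \<omega> in M n. iexp (t * Y n \<omega>) =
          exp (- (\<i> * of_real (s t n * ln (fact (n - 1))))) * imag_power (s t n) (D \<omega>)"
        using D0
      proof eventually_elim
        case (elim \<omega>)
        have "\<i> * of_real (t * Y n \<omega>) = - (\<i> * of_real (s t n * ln (fact (n - 1)))) + \<i> * of_real (s t n * ln (D \<omega>))"
          unfolding Y_eq[OF elim] s_def by (simp add: diff_divide_distrib right_diff_distrib)
        then show ?case using elim by (simp only: imag_power_def exp_add if_True)
      qed
    qed (use Y in measurable)
    also have "\<dots> = exp (- (\<i> * of_real (s t n * ln (fact (n - 1))))) * (\<Prod>k=1..n. chi_square_mellin k (s t n))"
      using mellin[of "s t n"] by simp
    finally show "char (distr (M n) borel (Y n)) t = \<dots>" .
  qed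
  \<comment> \<open>The index is shifted because nothing is known about the measure with index 0,
    while the continuity theorem asks for a sequence of probability measures.\<close>
  have "weak_conv_m (\<lambda>n. distr (M (Suc n)) borel (Y (Suc n))) std_normal_distribution"
  proof (rule levy_continuity)
    show "real_distribution (distr (M (Suc n)) borel (Y (Suc n)))" for n
      using main(1)[of "Suc n"] assms(1)[of "Suc n"]
      by (auto simp: real_distribution_def real_distribution_axioms_def intro: prob_space.prob_space_distr)
    show "real_distribution std_normal_distribution"
      by (rule real_dist_normal_dist)
    show "(\<lambda>n. char (distr (M (Suc n)) borel (Y (Suc n))) t) \<longlonglongrightarrow> char std_normal_distribution t" for t
      using LIMSEQ_Suc[OF prod_chi_square_mellin_tendsto[of t]] main(2)[of "Suc _" t]
      by (simp add: s_def char_std_normal_distribution exp_of_real[symmetric])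
  qed
  then have "(\<lambda>n. cdf (distr (M n) borel (Y n)) x) \<longlonglongrightarrow> cdf std_normal_distribution x"
    if "isCont (cdf std_normal_distribution) x" for x
    using that LIMSEQ_imp_Suc[of "\<lambda>n. cdf (distr (M n) borel (Y n)) x"]
    by (simp add: weak_conv_m_def weak_conv_def)
  then show ?thesis
    unfolding weak_conv_m_def weak_conv_def Y_def by blast
qed

end
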